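(* Let $\mathscr{B}\subset\mathbb{N}\setminus\{1\}$ be a primitive set. Then either $\mathrm{Aut}(\{0,1\}^{\mathbb{Z}})$ embeds into $\mathrm{Aut}(\mathbb{A}_{\mathscr{B}})$ (i.e. there is an injective group homomorphism $\mathrm{Aut}(\{0,1\}^{\mathbb{Z}})\to\mathrm{Aut}(\mathbb{A}_{\mathscr{B}})$), or $\mathrm{Aut}(\mathbb{A}_{\mathscr{B}})$ is trivial.
   Context: A set $\mathscr{B}\subset\mathbb{N}$ is primitive if $b\nmid b'$ for all distinct $b,b'\in\mathscr{B}$. A subshift is a closed subset $X\subseteq\{0,1\}^{\mathbb{Z}}$ invariant under the left shift $\sigma$, $(\sigma x)[n]=x[n+1]$. $\mathrm{Aut}(X)$ is the group, under composition, of all homeomorphisms $X\to X$ commuting with $\sigma$; it is called trivial if it equals $\{\sigma^n:n\in\mathbb{Z}\}$. A set $A\subset\mathbb{Z}$ is $\mathscr{B}$-admissible if for every $b\in\mathscr{B}$ one has $|A \bmod b|<b$. A sequence $x\in\{0,1\}^{\mathbb{Z}}$ is $\mathscr{B}$-admissible if its support $\{n\in\mathbb{Z}:x[n]\neq0\}$ is $\mathscr{B}$-admissible. $\mathbb{A}_{\mathscr{B}}$ denotes the subshift of all $\mathscr{B}$-admissible sequences; if $\mathscr{B}=\emptyset$ then $\mathbb{A}_{\mathscr{B}}=\{0,1\}^{\mathbb{Z}}$. *)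

theory Defs
  imports "HOL-Analysis.Analysis" "HOL-Algebra.Bij"
begin

text \<open>
  The space of bi-infinite binary sequences is the type \<^typ>\<open>int \<Rightarrow> bool\<close> (\<^term>\<open>True\<close> is the
  symbol 1), with the library's product topology of the discrete topology on \<^typ>\<open>bool\<close>.
\<close>

definition shift :: "(int \<Rightarrow> bool) \<Rightarrow> (int \<Rightarrow> bool)" where
  "shift x = (\<lambda>n. x (n + 1))"

definition subshift :: "(int \<Rightarrow> bool) set \<Rightarrow> bool" where
  "subshift X \<longleftrightarrow> closed X \<and> shift ` X = X"

text \<open>
  As in \<^const>\<open>BijGroup\<close>, elements are extensional functions (\<^const>\<open>undefined\<close> outside \<open>X\<close>), so that
  equality of group elements is equality of maps on \<open>X\<close>.
\<close>

definition Aut :: "(int \<Rightarrow> bool) set \<Rightarrow> ((int \<Rightarrow> bool) \<Rightarrow> (int \<Rightarrow> bool)) monoid" where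
  "Aut X = BijGroup X
     \<lparr>carrier := {f \<in> Bij X. (\<exists>g. homeomorphism X X f g) \<and> (\<forall>x\<in>X. f (shift x) = shift (f x))}\<rparr>"

definition trivial_Aut :: "(int \<Rightarrow> bool) set \<Rightarrow> bool" where
  "trivial_Aut X \<longleftrightarrow> carrier (Aut X) = {restrict shift X [^]\<^bsub>Aut X\<^esub> n |n::int. True}"

definition primitive :: "nat set \<Rightarrow> bool" where
  "primitive B \<longleftrightarrow> (\<forall>b\<in>B. \<forall>b'\<in>B. b \<noteq> b' \<longrightarrow> \<not> b dvd b')"

definition admissible_set :: "nat set \<Rightarrow> int set \<Rightarrow> bool" where
  "admissible_set B A \<longleftrightarrow> (\<forall>b\<in>B. card ((\<lambda>n. n mod int b) ` A) < b)"

definition support :: "(int \<Rightarrow> bool) \<Rightarrow> int set" where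
  "support x = {n. x n}"

definition admissible_shift :: "nat set \<Rightarrow> (int \<Rightarrow> bool) set" where
  "admissible_shift B = {x. admissible_set B (support x)}"

lemma admissible_shift_empty: "admissible_shift {} = UNIV"
  by (simp add: admissible_shift_def admissible_set_def)

lemma group_Aut:
  assumes X: "subshift X"
  shows "group (Aut X)"
proof -
  let ?H = "{f \<in> Bij X. (\<exists>g. homeomorphism X X f g) \<and> (\<forall>x\<in>X. f (shift x) = shift (f x))}"
  interpret BG: group "BijGroup X" by (rule group_BijGroup)
  have sX: "shift x \<in> X" if "x \<in> X" for x
    using X that by (auto simp: subshift_def)
  have "subgroup ?H (BijGroup X)"
  proof (rule BG.subgroupI)
    show "?H \<subseteq> carrier (BijGroup X)" by (auto simp: BijGroup_def)
    have "homeomorphism X X (\<lambda>x\<in>X. x) (\<lambda>x\<in>X. x)"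
      by (auto simp: homeomorphism_def cong: continuous_on_cong)
    then have "(\<lambda>x\<in>X. x) \<in> ?H" using sX by (auto simp: id_Bij)
    then show "?H \<noteq> {}" by blast
  next
    fix f assume f: "f \<in> ?H"
    then obtain g where g: "homeomorphism X X f g" by blast
    have fB: "f \<in> Bij X" using f by blast
    have inj: "inj_on f X" and im: "f ` X = X" using fB by (auto simp: Bij_def bij_betw_def)
    let ?i = "\<lambda>x\<in>X. inv_into X f x"
    have gX: "g y \<in> X" and fg: "f (g y) = y" if "y \<in> X" for y
      using g that by (auto simp: homeomorphism_def)
    have eq: "inv_into X f y = g y" if "y \<in> X" for y
      using inj gX[OF that] fg[OF that] by (metis inv_into_f_f)
    have "homeomorphism X X g f" using g by (rule homeomorphism_symD)
    then have "homeomorphism X X ?i f"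
      by (rule homeomorphism_cong) (auto simp: eq)
    moreover have "?i (shift y) = shift (?i y)" if y: "y \<in> X" for y
    proof -
      have "f (shift (g y)) = shift y" using f gX[OF y] fg[OF y] by simp
      then have "g (shift y) = shift (g y)"
        using inj sX[OF gX[OF y]] eq[OF sX[OF y]] by (metis inv_into_f_f)
      then show ?thesis using y sX[OF y] by (simp add: eq)
    qed
    ultimately show "inv\<^bsub>BijGroup X\<^esub> f \<in> ?H"
      unfolding inv_BijGroup[OF fB] using restrict_inv_into_Bij[OF fB] by blast
  next
    fix f h assume f: "f \<in> ?H" and h: "h \<in> ?H"
    then obtain f' h' where "homeomorphism X X f f'" "homeomorphism X X h h'" by blast
    then have "homeomorphism X X (f \<circ> h) (h' \<circ> f')" by (rule homeomorphism_compose[rotated])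
    then have "homeomorphism X X (compose X f h) (h' \<circ> f')"
      by (rule homeomorphism_cong) (auto simp: compose_def)
    moreover have "h x \<in> X" if "x \<in> X" for x
      using h that by (auto dest: Bij_imp_funcset)
    ultimately show "f \<otimes>\<^bsub>BijGroup X\<^esub> h \<in> ?H"
      using f h sX by (auto simp: BijGroup_def compose_Bij compose_eq)
  qed
  then show ?thesis
    unfolding Aut_def by (rule BG.subgroup_imp_group)
qed

lemma restrict_shift_in_Aut:
  assumes X: "subshift X"
  shows "restrict shift X \<in> carrier (Aut X)"
proof -
  let ?s' = "\<lambda>x n. x (n - 1) :: bool"
  have c: "continuous_on X (\<lambda>x n. x (n + k) :: bool)" for k :: int
  proof (rule continuous_on_coordinatewise_then_product)
    fix i
    have "continuous_on UNIV (\<lambda>x :: int \<Rightarrow> bool. x (i + k))"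
      by (rule continuous_on_product_coordinates)
    then show "continuous_on X (\<lambda>x. x (i + k))" by (rule continuous_on_subset) simp
  qed
  have c1: "continuous_on X shift" using c[of 1] by (simp add: shift_def[abs_def])
  have c2: "continuous_on X ?s'" using c[of "-1"] by simp
  have inv: "?s' (shift x) = x" "shift (?s' x) = x" for x by (auto simp: shift_def)
  have im: "shift ` X = X" using X by (simp add: subshift_def)
  have "?s' ` shift ` X = X" by (simp only: image_image inv image_ident)
  then have im': "?s' ` X = X" by (simp only: im)
  have hs: "homeomorphism X X shift ?s'"
    using c1 c2 im im' inv by (simp add: homeomorphism_def)
  then have "homeomorphism X X (restrict shift X) ?s'"
    by (rule homeomorphism_cong) auto
  moreover have "inj_on shift X" using inv(1) by (metis inj_onI)
  then have "restrict shift X \<in> Bij X"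
    using im by (auto simp: Bij_def bij_betw_def inj_on_def)
  ultimately show ?thesis
    using im by (auto simp: Aut_def)
qed

lemma subshift_admissible_shift: "subshift (admissible_shift B)"
proof -
  have adm_shift: "admissible_set B (support (\<lambda>n. x (n + k))) \<longleftrightarrow> admissible_set B (support x)"
    for x and k :: int
  proof -
    have "card ((\<lambda>n. n mod int b) ` support (\<lambda>n. x (n + k))) =
          card ((\<lambda>n. n mod int b) ` support x)" for b
    proof -
      let ?m = "\<lambda>n. n mod int b"
      have im: "?m ` support x = (\<lambda>r. (r + k) mod int b) ` ?m ` support (\<lambda>n. x (n + k))"
      proof -
        have "support x = (\<lambda>n. n + k) ` support (\<lambda>n. x (n + k))"
        proof (intro equalityI subsetI)
          fix m assume "m \<in> support x"
          then have "m - k \<in> support (\<lambda>n. x (n + k))" by (simp add: support_def)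
          then show "m \<in> (\<lambda>n. n + k) ` support (\<lambda>n. x (n + k))" by (intro image_eqI[of _ _ "m - k"]) auto
        qed (auto simp: support_def)
        then show ?thesis by (simp add: image_image mod_add_left_eq)
      qed
      have "inj_on (\<lambda>r. (r + k) mod int b) (?m ` support (\<lambda>n. x (n + k)))"
      proof (rule inj_onI; clarsimp)
        fix n n' assume "(n mod int b + k) mod int b = (n' mod int b + k) mod int b"
        then have "(n + k) mod int b = (n' + k) mod int b" by (simp add: mod_add_left_eq)
        then have "((n + k) - k) mod int b = ((n' + k) - k) mod int b" by (rule mod_diff_cong) simp
        then show "n mod int b = n' mod int b" by simp
      qed
      then show ?thesis using im by (simp add: card_image)
    qed
    then show ?thesis by (simp add: admissible_set_def)
  qed
  have "shift ` admissible_shift B = admissible_shift B"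
  proof (intro equalityI subsetI)
    fix y assume "y \<in> shift ` admissible_shift B"
    then show "y \<in> admissible_shift B"
      using adm_shift[of _ 1] by (auto simp: admissible_shift_def shift_def)
  next
    fix y assume "y \<in> admissible_shift B"
    then have "(\<lambda>n. y (n + (-1))) \<in> admissible_shift B"
      using adm_shift[of y "-1"] by (simp add: admissible_shift_def)
    moreover have "y = shift (\<lambda>n. y (n + (-1)))" by (simp add: shift_def)
    ultimately show "y \<in> shift ` admissible_shift B" by blast
  qed
  moreover have "open (- admissible_shift B)"
  proof (subst open_subopen, intro ballI)
    fix x assume "x \<in> - admissible_shift B"
    then obtain b where b: "b \<in> B" and ge: "card ((\<lambda>n. n mod int b) ` support x) \<ge> b"
      by (auto simp: admissible_shift_def admissible_set_def not_less)
    let ?m = "\<lambda>n. n mod int b"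
    obtain F where F: "finite F" "F \<subseteq> support x" "card (?m ` F) \<ge> b"
    proof -
      obtain C where C: "C \<subseteq> ?m ` support x" "card C = b" "finite C"
        using ge by (metis obtain_subset_with_card_n)
      obtain F where "F \<subseteq> support x" "finite F" "C = ?m ` F"
        using finite_subset_image[OF C(3,1)] by metis
      then show ?thesis using C that by auto
    qed
    define T where "T = {y :: int \<Rightarrow> bool. \<forall>n\<in>F. y n \<in> {True}}"
    have "open T"
      unfolding T_def using F(1) by (intro product_topology_basis') (auto intro: open_discrete)
    moreover have "x \<in> T" using F(2) by (auto simp: T_def support_def)
    moreover have "T \<subseteq> - admissible_shift B"
    proof
      fix y assume "y \<in> T"
      then have FS: "F \<subseteq> support y" by (auto simp: T_def support_def)
      show "y \<in> - admissible_shift B"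
      proof (cases "b = 0")
        case True
        then show ?thesis using b by (auto simp: admissible_shift_def admissible_set_def)
      next
        case False
        then have "?m ` support y \<subseteq> {0..<int b}" by auto
        then have "finite (?m ` support y)" by (rule finite_subset) simp
        then have "card (?m ` F) \<le> card (?m ` support y)" using FS by (intro card_mono) auto
        then show ?thesis using b F(3) by (force simp: admissible_shift_def admissible_set_def)
      qed
    qed
    ultimately show "\<exists>T. open T \<and> x \<in> T \<and> T \<subseteq> - admissible_shift B" by blast
  qed
  ultimately show ?thesis by (simp add: subshift_def closed_def)
qed

end

theory Submission
  imports Defs
begin

text \<open>
  Identify a sequence with its support, and call a set of integers \<open>B0\<close>-admissible if for every
  \<open>b \<in> B0\<close> it misses a residue class modulo \<open>b\<close>. The dichotomy is governed by one question: is there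
  a finite admissible pattern \<open>W\<close> and a finite \<open>B0 \<subseteq> B\<close> such that every \<open>B0\<close>-admissible set that
  contains \<open>W\<close> is already \<open>B\<close>-admissible?

  Suppose that there is. Only finitely many moduli matter for sets that contain \<open>W\<close>, so among these
  sets there is a maximal periodic one, \<open>A\<close>. A sufficiently long piece of \<open>A\<close> forces: every admissible
  set that contains it lies inside \<open>A\<close> (\<open>periodic_if_finitely_forced\<close>). Inside \<open>A\<close> all symbols can be
  changed freely, because subsets of \<open>A\<close> are admissible. Hence this long piece, followed by two free
  symbols surrounded by zeros, is a block whose two data bits can be rewritten without leaving the
  subshift, and distinct occurrences of blocks do not overlap. The data bits in a maximal run of
  adjacent blocks are arranged on a conveyor belt: the first bits are read from left to right, the
  second bits from right to left, and the two tracks are glued at the ends of the run. Every cell then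
  sees a bi-infinite binary sequence, possibly periodic, and an automorphism of the full shift can be
  applied to it. This respects composition, and it is injective because infinite runs carry
  arbitrary sequences on their first track (\<open>Aut_full_shift_embeds\<close>, \<open>embeds_if_periodic\<close>).

  Suppose that there is no such pair. Then for every finite admissible \<open>W\<close> and every point \<open>p \<notin> W\<close>
  there is a finite admissible \<open>F \<supseteq> W\<close> that, for some \<open>b \<in> B\<close>, meets every class modulo \<open>b\<close> except
  that of \<open>p\<close>; in particular \<open>F \<union> {p}\<close> is not admissible (\<open>saturate\<close>). The points of \<open>F\<close> can moreover
  be moved arbitrarily far away and apart without changing the residues that matter (\<open>sparse_copy\<close>).
  Let \<open>\<phi>\<close> be an automorphism. The image of the sequence with the single \<open>1\<close> at the origin is not zero;
  let it have a \<open>1\<close> at \<open>s\<close>. If \<open>\<phi> x\<close> had a \<open>1\<close> at \<open>p + s\<close> although \<open>x\<close> has a \<open>0\<close> at \<open>p\<close>, take for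
  \<open>W\<close> the part of \<open>x\<close> in the finite window that determines \<open>\<phi> x\<close> at \<open>p + s\<close>, and add a sparse copy
  \<open>G\<close> of \<open>F\<close>. The image of the admissible set \<open>W \<union> G\<close> contains \<open>p + s\<close> and \<open>G + s\<close>, so it meets all
  classes modulo \<open>b\<close>, which is absurd. So \<open>\<phi> x\<close> is contained in the translate of \<open>x\<close> by \<open>s\<close>; the same
  for the inverse of \<open>\<phi>\<close> gives equality (\<open>Aut_is_shift_power\<close>).
\<close>

section \<open>Continuity on sequence space\<close>

lemma continuous_on_iff_finitely_determined:
  fixes h :: "(int \<Rightarrow> bool) \<Rightarrow> bool"
  shows "continuous_on X h \<longleftrightarrow>
    (\<forall>x\<in>X. \<exists>S. finite S \<and> (\<forall>y\<in>X. (\<forall>i\<in>S. y i = x i) \<longrightarrow> h y = h x))"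
proof (intro iffI ballI)
  fix x assume h: "continuous_on X h" and x: "x \<in> X"
  obtain U where U: "open U" "x \<in> U" "\<forall>y\<in>X. y \<in> U \<longrightarrow> h y \<in> {h x}"
    using h[unfolded continuous_on_topological, rule_format, OF x open_discrete, of "{h x}"]
    by auto
  obtain V where V: "x \<in> Pi\<^sub>E UNIV V" "finite {i. V i \<noteq> UNIV}" "Pi\<^sub>E UNIV V \<subseteq> U"
    using product_topology_open_contains_basis[of "\<lambda>_. euclidean" UNIV U x] U(1,2)
    by (auto simp: open_fun_def)
  have "y \<in> U" if "\<forall>i\<in>{i. V i \<noteq> UNIV}. y i = x i" for y
  proof -
    have "y i \<in> V i" for i
      using that V(1) by (cases "V i = UNIV") (auto simp: PiE_iff)
    then have "y \<in> Pi\<^sub>E UNIV V" by auto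
    then show ?thesis using V(3) by blast
  qed
  then show "\<exists>S. finite S \<and> (\<forall>y\<in>X. (\<forall>i\<in>S. y i = x i) \<longrightarrow> h y = h x)"
    using U(3) V(2) by (intro exI[of _ "{i. V i \<noteq> UNIV}"]) simp
next
  assume det: "\<forall>x\<in>X. \<exists>S. finite S \<and> (\<forall>y\<in>X. (\<forall>i\<in>S. y i = x i) \<longrightarrow> h y = h x)"
  show "continuous_on X h"
    unfolding continuous_on_topological
  proof (intro ballI allI impI)
    fix x U assume x: "x \<in> X" and U: "h x \<in> U"
    obtain S where S: "finite S" "\<forall>y\<in>X. (\<forall>i\<in>S. y i = x i) \<longrightarrow> h y = h x"
      using det x by blast
    have "open {y :: int \<Rightarrow> bool. \<forall>i\<in>S. y i \<in> {x i}}"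
      by (rule product_topology_basis'[of S "\<lambda>i. {x i}" "\<lambda>i. i", OF S(1) open_discrete])
    then show "\<exists>A. open A \<and> x \<in> A \<and> (\<forall>y\<in>X. y \<in> A \<longrightarrow> h y \<in> U)"
      using S(2) U by (intro exI[of _ "{y. \<forall>i\<in>S. y i \<in> {x i}}"] conjI) simp_all
  qed
qed

text \<open>
  Basic open sets constrain finitely many coordinates, and every symbol is an isolated point. Hence
  continuity means that each output symbol is decided, near each point, by a finite window.
\<close>

lemma continuous_on_sequences_iff:
  fixes f :: "(int \<Rightarrow> bool) \<Rightarrow> int \<Rightarrow> bool"
  shows "continuous_on X f \<longleftrightarrow>
    (\<forall>n. \<forall>x\<in>X. \<exists>S. finite S \<and> (\<forall>y\<in>X. (\<forall>i\<in>S. y i = x i) \<longrightarrow> f y n = f x n))"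
proof -
  have "continuous_on X f \<longleftrightarrow> (\<forall>n. continuous_on X (\<lambda>x. f x n))"
    (is "?l \<longleftrightarrow> ?r")
  proof
    assume ?l
    then show ?r using continuous_on_product_then_coordinatewise[of X f] by simp
  next
    assume ?r
    then show ?l using continuous_on_coordinatewise_then_product[of X f] by simp
  qed
  then show ?thesis by (simp add: continuous_on_iff_finitely_determined)
qed

section \<open>Automorphisms\<close>

lemma translate_mem:
  assumes "shift ` X = X" "x \<in> X"
  shows "(\<lambda>n. x (n + k)) \<in> X"
proof -
  have *: "(\<lambda>n. x (n + k)) \<in> X \<longleftrightarrow> (\<lambda>n. x (n + (k + 1))) \<in> X" for k
  proof -
    have "(\<lambda>n. x (n + (k + 1))) = shift (\<lambda>n. x (n + k))"
      by (simp add: shift_def ac_simps)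
    moreover have "inj shift"
    proof (rule injI)
      fix x y assume "shift x = shift y"
      then have "x (n - 1 + 1) = y (n - 1 + 1)" for n
        unfolding shift_def by metis
      then show "x = y" by auto
    qed
    ultimately show ?thesis using assms(1) by (metis inj_image_mem_iff)
  qed
  show ?thesis
  proof (induction k rule: int_induct[of _ 0])
    case base then show ?case using assms(2) by simp
  next
    case (step1 i) then show ?case using * by blast
  next
    case (step2 i) then show ?case using *[of "i - 1"] by simp
  qed
qed

lemma translate_commute:
  assumes X: "shift ` X = X" and f: "\<And>x. x \<in> X \<Longrightarrow> f (shift x) = shift (f x)" and x: "x \<in> X"
  shows "f (\<lambda>n. x (n + k)) = (\<lambda>n. f x (n + k))"
proof -
  have *: "f (\<lambda>n. x (n + (k + 1))) = (\<lambda>n. f (\<lambda>n. x (n + k)) (n + 1))" for k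
    using f[OF translate_mem[OF X x, of k]] by (simp add: shift_def ac_simps)
  show ?thesis
  proof (induction k rule: int_induct[of _ 0])
    case base then show ?case by simp
  next
    case (step1 i) then show ?case unfolding * by (simp add: ac_simps)
  next
    case (step2 i)
    have "f (\<lambda>n. x (n + i)) (n - 1) = f (\<lambda>n. x (n + (i - 1))) n" for n
      using *[of "i - 1"] by simp
    then show ?case using step2 by (auto simp: algebra_simps)
  qed
qed

lemma Aut_carrier:
  "f \<in> carrier (Aut X) \<longleftrightarrow>
    f \<in> Bij X \<and> (\<exists>g. homeomorphism X X f g) \<and> (\<forall>x\<in>X. f (shift x) = shift (f x))"
  by (simp add: Aut_def)

lemma Aut_mult: "f \<in> carrier (Aut X) \<Longrightarrow> g \<in> carrier (Aut X) \<Longrightarrow> f \<otimes>\<^bsub>Aut X\<^esub> g = compose X f g"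
  by (simp add: Aut_def BijGroup_def)

lemma Aut_one: "\<one>\<^bsub>Aut X\<^esub> = (\<lambda>x\<in>X. x)"
  by (simp add: Aut_def BijGroup_def)

lemma Aut_continuous: "f \<in> carrier (Aut X) \<Longrightarrow> continuous_on X f"
  by (auto simp: Aut_carrier homeomorphism_def)

lemma Aut_image: "f \<in> carrier (Aut X) \<Longrightarrow> x \<in> X \<Longrightarrow> f x \<in> X"
  by (auto simp: Aut_carrier dest: Bij_imp_funcset)

lemma Aut_translate:
  assumes "subshift X" "f \<in> carrier (Aut X)" "x \<in> X"
  shows "f (\<lambda>n. x (n + k)) = (\<lambda>n. f x (n + k))"
  using assms by (intro translate_commute[of X]) (auto simp: Aut_carrier subshift_def)

lemma shift_power:
  assumes X: "subshift X" and x: "x \<in> X"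
  shows "(restrict shift X [^]\<^bsub>Aut X\<^esub> (k::int)) x = (\<lambda>n. x (n + k))"
proof -
  interpret group "Aut X" by (rule group_Aut[OF X])
  define s where "s = restrict shift X"
  have s: "s \<in> carrier (Aut X)" unfolding s_def by (rule restrict_shift_in_Aut[OF X])
  have im: "shift ` X = X" using X by (simp add: subshift_def)
  have step: "(s [^]\<^bsub>Aut X\<^esub> (k + 1)) x = (s [^]\<^bsub>Aut X\<^esub> k) (\<lambda>n. x (n + 1))" if "x \<in> X" for x and k :: int
    using that s by (simp add: int_pow_mult Aut_mult compose_eq) (simp add: s_def shift_def)
  have "\<forall>x\<in>X. (s [^]\<^bsub>Aut X\<^esub> k) x = (\<lambda>n. x (n + k))"
  proof (induction k rule: int_induct[of _ 0])
    case base then show ?case by (simp add: Aut_one)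
  next
    case (step1 i)
    show ?case
    proof
      fix x assume x: "x \<in> X"
      then have "(\<lambda>n. x (n + 1)) \<in> X" by (rule translate_mem[OF im])
      with step[OF x, of i] step1 show "(s [^]\<^bsub>Aut X\<^esub> (i + 1)) x = (\<lambda>n. x (n + (i + 1)))"
        by (simp add: algebra_simps)
    qed
  next
    case (step2 i)
    show ?case
    proof
      fix x assume "x \<in> X"
      then have "(\<lambda>n. x (n + (-1))) \<in> X" by (rule translate_mem[OF im])
      with step[OF this, of "i - 1"] step2 show "(s [^]\<^bsub>Aut X\<^esub> (i - 1)) x = (\<lambda>n. x (n + (i - 1)))"
        by (simp add: algebra_simps)
    qed
  qed
  then show ?thesis using x by (simp add: s_def)
qed

section \<open>Conveyor belts\<close>

text \<open>
  Let \<open>L k\<close> mean that there are blocks at \<open>k\<close> and at \<open>k + m\<close>, so that these two are joined. The cells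
  are the pairs \<open>(k, s)\<close>; the cells with \<open>s = True\<close> form the upper track, which moves to the right, and
  those with \<open>s = False\<close> the lower track, which moves to the left. At the end of a run the belt turns
  to the other track. Since the rule makes sense for every \<open>k\<close>, the step is a bijection of all cells,
  with inverse \<open>belt_prev\<close>.
\<close>

definition belt_next :: "int \<Rightarrow> (int \<Rightarrow> bool) \<Rightarrow> int \<times> bool \<Rightarrow> int \<times> bool" where
  "belt_next m L = (\<lambda>(k, s).
     if s then (if L k then (k + m, True) else (k, False))
     else (if L (k - m) then (k - m, False) else (k, True)))"

definition belt_prev :: "int \<Rightarrow> (int \<Rightarrow> bool) \<Rightarrow> int \<times> bool \<Rightarrow> int \<times> bool" where
  "belt_prev m L = (\<lambda>(k, s).
     if s then (if L (k - m) then (k - m, True) else (k, False))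
     else (if L k then (k + m, False) else (k, True)))"

definition belt_walk :: "int \<Rightarrow> (int \<Rightarrow> bool) \<Rightarrow> int \<Rightarrow> int \<times> bool \<Rightarrow> int \<times> bool" where
  "belt_walk m L i = (if i \<ge> 0 then belt_next m L ^^ nat i else belt_prev m L ^^ nat (- i))"

lemma belt_next_prev [simp]: "belt_next m L (belt_prev m L c) = c"
  by (cases c) (simp add: belt_next_def belt_prev_def)

lemma belt_prev_next [simp]: "belt_prev m L (belt_next m L c) = c"
  by (cases c) (simp add: belt_next_def belt_prev_def)

lemma belt_walk_0 [simp]: "belt_walk m L 0 c = c"
  by (simp add: belt_walk_def)

lemma belt_walk_Suc: "belt_walk m L (i + 1) c = belt_next m L (belt_walk m L i c)"
proof (cases "i \<ge> 0")
  case True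
  then have "nat (i + 1) = Suc (nat i)" by simp
  then show ?thesis using True by (simp add: belt_walk_def)
next
  case False
  then have "nat (- i) = Suc (nat (- (i + 1)))" by simp
  then show ?thesis using False by (auto simp: belt_walk_def)
qed

lemma belt_walk_pred: "belt_walk m L (i - 1) c = belt_prev m L (belt_walk m L i c)"
  using belt_walk_Suc[of m L "i - 1" c] by simp

lemma belt_walk_add: "belt_walk m L (i + j) c = belt_walk m L i (belt_walk m L j c)"
proof (induction i rule: int_induct[of _ 0])
  case (step1 i)
  then show ?case using belt_walk_Suc[of m L "i + j" c] belt_walk_Suc[of m L i]
    by (simp add: ac_simps)
next
  case (step2 i)
  then show ?case using belt_walk_pred[of m L "i + j" c] belt_walk_pred[of m L i]
    by (simp add: algebra_simps)
qed simp

lemma belt_walk_translate: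
  "belt_walk m (\<lambda>n. L (n + a)) i (k, s) =
   (case belt_walk m L i (k + a, s) of (k', s') \<Rightarrow> (k' - a, s'))"
proof (induction i rule: int_induct[of _ 0])
  case (step1 i)
  then show ?case
    by (simp add: belt_walk_Suc belt_next_def split: prod.splits) (auto simp: algebra_simps)
next
  case (step2 i)
  then show ?case
    by (simp add: belt_walk_pred belt_prev_def split: prod.splits) (auto simp: algebra_simps)
qed simp

text \<open>
  The cells along a belt see translates of one sequence. Commuting with the shift makes the results
  at these cells fit together to one sequence again.
\<close>

definition equivariant :: "((int \<Rightarrow> bool) \<Rightarrow> int \<Rightarrow> bool) \<Rightarrow> bool" where
  "equivariant f \<longleftrightarrow> (\<forall>x. f (shift x) = shift (f x))"

lemma shift_UNIV: "shift ` UNIV = UNIV"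
  using subshift_admissible_shift[of "{}"] by (simp add: admissible_shift_empty subshift_def)

text \<open>
  Data positions are exempt from the comparison with the word \<open>c\<close>, so that a block stays a block
  when its two data bits are rewritten.
\<close>

definition block_at :: "int \<Rightarrow> (bool \<Rightarrow> int) \<Rightarrow> (int \<Rightarrow> bool) \<Rightarrow> (int \<Rightarrow> bool) \<Rightarrow> int \<Rightarrow> bool" where
  "block_at m p c x k \<longleftrightarrow> (\<forall>n\<in>{0..<m} - range p. x (k + n) = c n)"

locale conveyor =
  fixes X :: "(int \<Rightarrow> bool) set" and m :: int and p :: "bool \<Rightarrow> int" and c :: "int \<Rightarrow> bool"
  assumes X: "subshift X"
    and data: "\<And>s. p s \<in> {0..<m}" "inj p"
    and no_overlap: "\<And>x k j. block_at m p c x k \<Longrightarrow> block_at m p c x j \<Longrightarrow> k < j \<Longrightarrow> k + m \<le> j"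
    and rewritable: "\<And>x y. x \<in> X \<Longrightarrow>
      (\<And>n. y n \<noteq> x n \<Longrightarrow> \<exists>k s. block_at m p c x k \<and> n = k + p s) \<Longrightarrow> y \<in> X"
    and bi_infinite: "\<And>z. \<exists>x\<in>X. \<forall>i. block_at m p c x (m * i) \<and> x (m * i + p True) = z i"
begin

abbreviation occ :: "(int \<Rightarrow> bool) \<Rightarrow> int \<Rightarrow> bool" where
  "occ \<equiv> block_at m p c"

definition link :: "(int \<Rightarrow> bool) \<Rightarrow> int \<Rightarrow> bool" where
  "link x k \<longleftrightarrow> occ x k \<and> occ x (k + m)"

definition tape :: "(int \<Rightarrow> bool) \<Rightarrow> int \<times> bool \<Rightarrow> int \<Rightarrow> bool" where
  "tape x cl i = (case belt_walk m (link x) i cl of (k, s) \<Rightarrow> x (k + p s))"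

text \<open>
  Distinct cells of blocks have distinct data positions, so at most one of the first two cases
  applies.
\<close>

definition recode :: "((int \<Rightarrow> bool) \<Rightarrow> int \<Rightarrow> bool) \<Rightarrow> (int \<Rightarrow> bool) \<Rightarrow> int \<Rightarrow> bool" where
  "recode f x n =
    (if occ x (n - p True) then f (tape x (n - p True, True)) 0
     else if occ x (n - p False) then f (tape x (n - p False, False)) 0
     else x n)"

lemma same_block:
  assumes "occ x k" "occ x j" "k + n = j + n'" "n \<in> {0..<m}" "n' \<in> {0..<m}"
  shows "j = k"
  using no_overlap[OF assms(1,2)] no_overlap[OF assms(2,1)] assms(3-5)
  by (cases j k rule: linorder_cases) auto

lemma recode_data:
  assumes "occ x k"
  shows "recode f x (k + p s) = f (tape x (k, s)) 0"
proof (cases s)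
  case False
  have "\<not> occ x (k + p False - p True)"
    using same_block[OF assms, of "k + p False - p True" "p False" "p True"] data(1) injD[OF data(2)]
    by auto
  then show ?thesis using False assms by (simp add: recode_def)
qed (use assms in \<open>simp add: recode_def\<close>)

lemma recode_other:
  assumes "\<And>k s. occ x k \<Longrightarrow> n \<noteq> k + p s"
  shows "recode f x n = x n"
  using assms[of "n - p True" True] assms[of "n - p False" False] by (auto simp: recode_def)

lemma occ_cong:
  assumes "\<And>n. n \<in> {0..<m} - range p \<Longrightarrow> y (k + n) = x (k + n)"
  shows "occ y k = occ x k"
  using assms by (auto simp: block_at_def)

text \<open>
  Rewriting data bits neither destroys nor creates blocks. No block is destroyed because changes are
  confined to data positions of blocks, and these never lie in the fixed part of another block. If a
  new block were created, it would share a position with an old one, which has survived, and the two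
  would overlap in the new sequence.
\<close>

lemma occ_recode: "occ (recode f x) k = occ x k"
proof -
  have keep: "occ (recode f x) k" if "occ x k" for k
  proof -
    have "occ (recode f x) k = occ x k"
    proof (rule occ_cong)
      fix n assume n: "n \<in> {0..<m} - range p"
      show "recode f x (k + n) = x (k + n)"
      proof (rule recode_other)
        fix j s assume j: "occ x j"
        show "k + n \<noteq> j + p s"
          using same_block[OF that j, of n "p s"] data(1) n by auto
      qed
    qed
    then show ?thesis using that by simp
  qed
  moreover have "occ x k" if k: "occ (recode f x) k"
  proof (rule ccontr)
    assume no: "\<not> occ x k"
    have "occ (recode f x) k = occ x k"
    proof (rule occ_cong)
      fix n assume n: "n \<in> {0..<m} - range p"
      show "recode f x (k + n) = x (k + n)"
      proof (rule recode_other)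
        fix j s assume j: "occ x j"
        show "k + n \<noteq> j + p s"
          using same_block[OF k keep[OF j], of n "p s"] data(1) n no j by auto
      qed
    qed
    then show False using k no by simp
  qed
  ultimately show ?thesis by blast
qed

lemma link_recode: "link (recode f x) = link x"
  by (simp add: link_def occ_recode fun_eq_iff)

lemma occ_belt_walk:
  assumes "occ x k"
  shows "occ x (fst (belt_walk m (link x) i (k, s)))"
proof (induction i rule: int_induct[of _ 0])
  case base then show ?case using assms by simp
next
  case (step1 i)
  then show ?case
    by (auto simp: belt_walk_Suc belt_next_def link_def split: prod.splits)
next
  case (step2 i)
  then show ?case
    by (auto simp: belt_walk_pred belt_prev_def link_def split: prod.splits)
qed

lemma tape_walk: "tape x (belt_walk m (link x) j cl) = (\<lambda>i. tape x cl (i + j))"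
  by (rule ext) (simp add: tape_def belt_walk_add)

text \<open>
  Neighbouring cells read translates of the same tape. Therefore applying \<open>f\<close> at each cell and
  keeping the symbol at the origin writes the sequence \<open>f (tape x (k, s))\<close> onto the belt.
\<close>

lemma tape_recode:
  assumes f: "equivariant f" and k: "occ x k"
  shows "tape (recode f x) (k, s) = f (tape x (k, s))"
proof
  fix i
  obtain k' s' where w: "belt_walk m (link x) i (k, s) = (k', s')" by fastforce
  have "occ x k'" using occ_belt_walk[OF k, of i s] w by simp
  then have "tape (recode f x) (k, s) i = f (tape x (k', s')) 0"
    by (simp add: tape_def[of "recode f x"] link_recode w recode_data)
  also have "\<dots> = f (\<lambda>n. tape x (k, s) (n + i)) 0"
    by (simp add: tape_walk flip: w)
  also have "\<dots> = f (tape x (k, s)) i"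
    using f by (subst translate_commute[of UNIV]) (auto simp: equivariant_def shift_UNIV)
  finally show "tape (recode f x) (k, s) i = f (tape x (k, s)) i" .
qed

lemma recode_compose:
  assumes "equivariant g"
  shows "recode f (recode g x) = recode (\<lambda>z. f (g z)) x"
proof
  fix n
  show "recode f (recode g x) n = recode (\<lambda>z. f (g z)) x n"
  proof (cases "\<exists>k s. occ x k \<and> n = k + p s")
    case True
    then show ?thesis by (auto simp: recode_data occ_recode tape_recode[OF assms])
  next
    case False
    then have none: "n \<noteq> k + p s" if "occ x k" for k s using that by blast
    have "recode f (recode g x) n = recode g x n"
      by (rule recode_other) (use none occ_recode in blast)
    then show ?thesis using none by (simp add: recode_other)
  qed
qed

lemma recode_id: "recode (\<lambda>z. z) x = x"
  by (auto simp: recode_def tape_def fun_eq_iff)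

lemma recode_shift: "recode f (shift x) = shift (recode f x)"
proof -
  have occ: "occ (shift x) k = occ x (k + 1)" for k
    by (simp add: block_at_def shift_def ac_simps)
  have link: "link (shift x) = (\<lambda>k. link x (k + 1))"
    by (simp add: link_def occ ac_simps fun_eq_iff)
  have tape: "tape (shift x) (k, s) = tape x (k + 1, s)" for k s
  proof
    fix i
    obtain k' s' where "belt_walk m (link x) i (k + 1, s) = (k', s')" by fastforce
    then show "tape (shift x) (k, s) i = tape x (k + 1, s) i"
      by (simp add: tape_def link belt_walk_translate) (simp add: shift_def algebra_simps)
  qed
  show ?thesis
    by (rule ext) (simp add: recode_def occ tape, simp add: shift_def recode_def algebra_simps)
qed

lemma recode_mem:
  assumes "x \<in> X"
  shows "recode f x \<in> X"
  using assms by (rule rewritable) (use recode_other in blast)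

text \<open>
  Each step of a walk consults only the blocks next to the current cell, so the cell reached after
  \<open>i\<close> steps is decided by finitely many symbols of \<open>x\<close>.
\<close>

lemma belt_walk_local:
  "\<exists>S. finite S \<and> (\<forall>y. (\<forall>i\<in>S. y i = x i) \<longrightarrow> belt_walk m (link y) i cl = belt_walk m (link x) i cl)"
proof -
  have occ_local: "occ y k = occ x k" if "\<forall>i\<in>{k..<k+m}. y i = x i" for y k
    using that by (intro occ_cong) auto
  have link_local: "link y k = link x k" if "\<forall>i\<in>{k..<k+2*m}. y i = x i" for y k
    using that occ_local[of k y] occ_local[of "k + m" y] by (auto simp: link_def)
  have step: "belt_next m (link y) cl = belt_next m (link x) cl \<and> belt_prev m (link y) cl = belt_prev m (link x) cl"
    if "\<forall>i\<in>{fst cl - m..<fst cl + 2*m}. y i = x i" for y cl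
  proof -
    have "m > 0" using data(1)[of True] by auto
    then have "link y (fst cl) = link x (fst cl)" "link y (fst cl - m) = link x (fst cl - m)"
      using that by (auto intro!: link_local)
    then show ?thesis by (auto simp: belt_next_def belt_prev_def split: prod.splits)
  qed
  show ?thesis
  proof (induction i rule: int_induct[of _ 0])
    case base then show ?case by auto
  next
    case (step1 i)
    then obtain S where S: "finite S"
      "\<And>y. (\<forall>i\<in>S. y i = x i) \<Longrightarrow> belt_walk m (link y) i cl = belt_walk m (link x) i cl" by blast
    define k where "k = fst (belt_walk m (link x) i cl)"
    have next_step: "belt_walk m (link y) (i + 1) cl = belt_walk m (link x) (i + 1) cl"
      if "\<forall>i\<in>S \<union> {k - m..<k + 2*m}. y i = x i" for y
      using that S(2)[of y] step[of "belt_walk m (link x) i cl" y]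
      by (simp add: belt_walk_Suc k_def)
    show ?case
      by (rule exI[of _ "S \<union> {k - m..<k + 2*m}"], intro conjI allI impI next_step)
        (simp_all add: S(1))
  next
    case (step2 i)
    then obtain S where S: "finite S"
      "\<And>y. (\<forall>i\<in>S. y i = x i) \<Longrightarrow> belt_walk m (link y) i cl = belt_walk m (link x) i cl" by blast
    define k where "k = fst (belt_walk m (link x) i cl)"
    have next_step: "belt_walk m (link y) (i - 1) cl = belt_walk m (link x) (i - 1) cl"
      if "\<forall>i\<in>S \<union> {k - m..<k + 2*m}. y i = x i" for y
      using that S(2)[of y] step[of "belt_walk m (link x) i cl" y]
      by (simp add: belt_walk_pred k_def)
    show ?case
      by (rule exI[of _ "S \<union> {k - m..<k + 2*m}"], intro conjI allI impI next_step)
        (simp_all add: S(1))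
  qed
qed

lemma tape_local:
  "\<exists>S. finite S \<and> (\<forall>y. (\<forall>i\<in>S. y i = x i) \<longrightarrow> tape y cl i = tape x cl i)"
proof -
  obtain S where S: "finite S"
    "\<And>y. (\<forall>i\<in>S. y i = x i) \<Longrightarrow> belt_walk m (link y) i cl = belt_walk m (link x) i cl"
    using belt_walk_local by blast
  obtain k s where w: "belt_walk m (link x) i cl = (k, s)" by fastforce
  have same: "tape y cl i = tape x cl i" if "\<forall>i\<in>insert (k + p s) S. y i = x i" for y
    using that S(2)[of y] by (simp add: tape_def w)
  show ?thesis
    by (rule exI[of _ "insert (k + p s) S"], intro conjI allI impI same) (simp_all add: S(1))
qed

lemma continuous_tape_code:
  fixes f :: "(int \<Rightarrow> bool) \<Rightarrow> int \<Rightarrow> bool"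
  assumes "continuous_on UNIV f"
  shows "\<exists>S. finite S \<and> (\<forall>y. (\<forall>i\<in>S. y i = x i) \<longrightarrow> f (tape y cl) 0 = f (tape x cl) 0)"
proof -
  obtain T where T: "finite T" "\<And>z. (\<forall>i\<in>T. z i = tape x cl i) \<Longrightarrow> f z 0 = f (tape x cl) 0"
    using bspec[OF spec[OF iffD1[OF continuous_on_sequences_iff assms], of 0] UNIV_I, of "tape x cl"]
    by auto
  have "\<forall>i. \<exists>S. finite S \<and> (\<forall>y. (\<forall>i\<in>S. y i = x i) \<longrightarrow> tape y cl i = tape x cl i)"
    using tape_local by blast
  from choice[OF this] obtain S
    where "\<forall>i. finite (S i) \<and> (\<forall>y. (\<forall>j\<in>S i. y j = x j) \<longrightarrow> tape y cl i = tape x cl i)" ..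
  then have S: "finite (S i)" "(\<forall>j\<in>S i. y j = x j) \<Longrightarrow> tape y cl i = tape x cl i" for i y
    by blast+
  have same: "f (tape y cl) 0 = f (tape x cl) 0" if "\<forall>i\<in>(\<Union>j\<in>T. S j). y i = x i" for y
    using that by (intro T(2) ballI S(2)) auto
  show ?thesis
    by (rule exI[of _ "\<Union>j\<in>T. S j"], intro conjI allI impI same) (simp_all add: T(1) S(1))
qed

lemma continuous_recode:
  assumes "continuous_on UNIV f"
  shows "continuous_on Y (recode f)"
  unfolding continuous_on_sequences_iff
proof (intro allI ballI)
  fix n x
  obtain S1 where S1: "finite S1"
    "\<forall>y. (\<forall>i\<in>S1. y i = x i) \<longrightarrow> f (tape y (n - p True, True)) 0 = f (tape x (n - p True, True)) 0"
    using continuous_tape_code[OF assms, of x "(n - p True, True)"] by (elim exE conjE)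
  obtain S2 where S2: "finite S2"
    "\<forall>y. (\<forall>i\<in>S2. y i = x i) \<longrightarrow> f (tape y (n - p False, False)) 0 = f (tape x (n - p False, False)) 0"
    using continuous_tape_code[OF assms, of x "(n - p False, False)"] by (elim exE conjE)
  define S where "S = insert n (S1 \<union> S2 \<union> {n - m .. n + m})"
  have same: "recode f y n = recode f x n" if y: "\<forall>i\<in>S. y i = x i" for y
  proof -
    have "occ y (n - p s) = occ x (n - p s)" for s
    proof (rule occ_cong)
      fix i assume "i \<in> {0..<m} - range p"
      then have "n - p s + i \<in> {n - m .. n + m}" using data(1)[of s] by auto
      then show "y (n - p s + i) = x (n - p s + i)" using y by (simp add: S_def)
    qed
    then show ?thesis
      using y S1(2)[THEN spec, of y] S2(2)[THEN spec, of y] by (simp add: recode_def S_def)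
  qed
  show "\<exists>S. finite S \<and> (\<forall>y\<in>Y. (\<forall>i\<in>S. y i = x i) \<longrightarrow> recode f y n = recode f x n)"
  proof (rule exI[of _ S], rule conjI)
    show "finite S" using S1(1) S2(1) by (simp add: S_def)
    show "\<forall>y\<in>Y. (\<forall>i\<in>S. y i = x i) \<longrightarrow> recode f y n = recode f x n"
      using same by (rule ballI[OF impI])
  qed
qed

lemma recode_inverse:
  assumes "equivariant g" "\<And>z. f (g z) = z"
  shows "recode f (recode g x) = x"
  unfolding recode_compose[OF assms(1)] assms(2) by (rule recode_id)

lemma recode_Aut:
  assumes f: "f \<in> carrier (Aut UNIV)"
  shows "restrict (recode f) X \<in> carrier (Aut X)"
proof -
  obtain g where g: "homeomorphism UNIV UNIV f g" using f by (auto simp: Aut_carrier)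
  then have fg: "f (g z) = z" "g (f z) = z" for z by (auto simp: homeomorphism_def)
  have ef: "equivariant f" using f by (simp add: Aut_carrier equivariant_def)
  have eg: "equivariant g"
    unfolding equivariant_def
  proof
    fix z
    have "g (shift z) = g (f (shift (g z)))" using ef fg by (simp add: equivariant_def)
    then show "g (shift z) = shift (g z)" by (simp add: fg)
  qed
  have inv: "recode g (recode f x) = x" "recode f (recode g x) = x" for x
    using recode_inverse ef eg fg by auto
  have img: "recode f ` X = X" "recode g ` X = X"
    using recode_mem image_eqI[of _ "recode f", OF inv(2)[symmetric]]
      image_eqI[of _ "recode g", OF inv(1)[symmetric]] by auto
  have "homeomorphism X X (recode f) (recode g)"
    using g img inv by (auto simp: homeomorphism_def intro: continuous_recode)
  then have hom: "homeomorphism X X (restrict (recode f) X) (recode g)"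
    by (rule homeomorphism_cong) auto
  have bij: "restrict (recode f) X \<in> Bij X"
  proof -
    have "inj_on (recode f) X" using inv(1) by (metis inj_onI)
    then show ?thesis using img(1) by (auto simp: Bij_def bij_betw_def inj_on_def)
  qed
  have shift: "shift x \<in> X" if "x \<in> X" for x using X that by (auto simp: subshift_def)
  show ?thesis
    unfolding Aut_carrier
  proof (intro conjI ballI)
    show "\<exists>g. homeomorphism X X (restrict (recode f) X) g" using hom by blast
    show "restrict (recode f) X (shift x) = shift (restrict (recode f) X x)" if "x \<in> X" for x
      using that shift[OF that] by (simp add: recode_shift)
  qed (rule bij)
qed

text \<open>
  If blocks occur at all multiples of \<open>m\<close>, the upper track runs through them without ever turning,
  so it can carry any sequence \<open>z\<close>.
\<close>

lemma recode_inject: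
  assumes f: "equivariant f" "equivariant g" and eq: "\<And>x. x \<in> X \<Longrightarrow> recode f x = recode g x"
  shows "f = g"
proof
  fix z
  obtain x where x: "x \<in> X" "\<And>i. occ x (m * i)" "\<And>i. x (m * i + p True) = z i"
    using bi_infinite[of z] by blast
  have link: "link x (m * i)" for i
    using x(2)[of i] x(2)[of "i + 1"] by (simp add: link_def distrib_left)
  have "belt_walk m (link x) i (0, True) = (m * i, True)" for i
  proof (induction i rule: int_induct[of _ 0])
    case (step1 i)
    then show ?case using link[of i] by (simp add: belt_walk_Suc belt_next_def distrib_left)
  next
    case (step2 i)
    then show ?case using link[of "i - 1"]
      by (simp add: belt_walk_pred belt_prev_def right_diff_distrib)
  qed simp
  then have tape: "tape x (0, True) = z"
    by (simp add: tape_def x(3) fun_eq_iff)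
  have occ: "occ x 0" using x(2)[of 0] by simp
  have "f z = tape (recode f x) (0, True)" by (simp add: tape_recode[OF f(1) occ] tape)
  also have "\<dots> = tape (recode g x) (0, True)" by (simp add: eq[OF x(1)])
  also have "\<dots> = g z" by (simp add: tape_recode[OF f(2) occ] tape)
  finally show "f z = g z" .
qed

theorem Aut_full_shift_embeds:
  "(\<lambda>f. restrict (recode f) X) \<in> mon (Aut UNIV) (Aut X)"
proof -
  have eq: "equivariant f" if "f \<in> carrier (Aut UNIV)" for f
    using that by (simp add: Aut_carrier equivariant_def)
  have "restrict (recode (f \<otimes>\<^bsub>Aut UNIV\<^esub> g)) X = restrict (recode f) X \<otimes>\<^bsub>Aut X\<^esub> restrict (recode g) X"
    if fg: "f \<in> carrier (Aut UNIV)" "g \<in> carrier (Aut UNIV)" for f g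
  proof -
    have "f \<otimes>\<^bsub>Aut UNIV\<^esub> g = (\<lambda>z. f (g z))"
      by (simp add: Aut_mult[OF fg] compose_def restrict_def)
    then show ?thesis
      using recode_mem
      by (simp add: Aut_mult[OF recode_Aut[OF fg(1)] recode_Aut[OF fg(2)]] compose_def
          recode_compose[OF eq[OF fg(2)]] cong: restrict_cong)
  qed
  moreover have "inj_on (\<lambda>f. restrict (recode f) X) (carrier (Aut UNIV))"
  proof (rule inj_onI)
    fix f g assume fg: "f \<in> carrier (Aut UNIV)" "g \<in> carrier (Aut UNIV)"
      and same: "restrict (recode f) X = restrict (recode g) X"
    show "f = g"
      using eq[OF fg(1)] eq[OF fg(2)]
    proof (rule recode_inject)
      fix x assume "x \<in> X"
      then show "recode f x = recode g x" using fun_cong[OF same, of x] by simp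
    qed
  qed
  ultimately show ?thesis
    using recode_Aut by (auto simp: mon_def hom_def)
qed

end

section \<open>Admissible sets\<close>

lemma card_residues_less_iff:
  assumes "b > 0"
  shows "card ((\<lambda>n. n mod int b) ` A) < b \<longleftrightarrow> (\<exists>r. \<forall>n\<in>A. \<not> int b dvd n - r)"
proof
  let ?R = "(\<lambda>n. n mod int b) ` A"
  assume "card ?R < b"
  moreover have "?R \<subseteq> {0..<int b}" using assms by auto
  ultimately obtain r where r: "r \<in> {0..<int b}" "r \<notin> ?R"
    by (metis card_atLeastLessThan_int diff_zero nat_int order_less_irrefl subsetI subset_antisym)
  have "\<not> int b dvd n - r" if "n \<in> A" for n
    using r that by (auto simp: mod_eq_dvd_iff[symmetric])
  then show "\<exists>r. \<forall>n\<in>A. \<not> int b dvd n - r" by blast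
next
  let ?R = "(\<lambda>n. n mod int b) ` A"
  assume "\<exists>r. \<forall>n\<in>A. \<not> int b dvd n - r"
  then obtain r where r: "\<forall>n\<in>A. \<not> int b dvd n - r" by blast
  then have "?R \<subseteq> {0..<int b} - {r mod int b}"
    using assms by (auto simp: mod_eq_dvd_iff)
  then have "card ?R \<le> card ({0..<int b} - {r mod int b})"
    by (intro card_mono) auto
  also have "\<dots> < b" using assms by (subst card_Diff_singleton) auto
  finally show "card ?R < b" .
qed

text \<open>
  A modulus 1 would exclude all nonempty sets. With moduli at least 2 single points are admissible,
  and their images under an automorphism are what the rigidity argument starts from.
\<close>

locale moduli =
  fixes B :: "nat set"
  assumes moduli_ge_2: "\<And>b. b \<in> B \<Longrightarrow> b \<ge> 2"
begin

lemma admissible_iff: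
  assumes "C \<subseteq> B"
  shows "admissible_set C A \<longleftrightarrow> (\<forall>b\<in>C. \<exists>r. \<forall>n\<in>A. \<not> int b dvd n - r)"
  unfolding admissible_set_def
proof (intro ball_cong refl)
  fix b assume "b \<in> C"
  then have "b > 0" using assms moduli_ge_2 by fastforce
  then show "card ((\<lambda>n. n mod int b) ` A) < b \<longleftrightarrow> (\<exists>r. \<forall>n\<in>A. \<not> int b dvd n - r)"
    by (rule card_residues_less_iff)
qed

lemma admissibleE:
  assumes "admissible_set C A" "b \<in> C" "C \<subseteq> B"
  obtains r where "\<forall>n\<in>A. \<not> int b dvd n - r"
  using assms by (auto simp: admissible_iff)

lemma admissible_mono:
  assumes "C \<subseteq> B" "admissible_set C A" "A' \<subseteq> A"
  shows "admissible_set C A'"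
  using assms by (simp add: admissible_iff) blast

lemma admissible_translate:
  assumes "C \<subseteq> B" "admissible_set C A" "\<And>n. n \<in> A' \<Longrightarrow> n + k \<in> A"
  shows "admissible_set C A'"
  unfolding admissible_iff[OF assms(1)]
proof
  fix b assume "b \<in> C"
  then obtain r where "\<forall>n\<in>A. \<not> int b dvd n - r"
    using assms(1,2) by (auto simp: admissible_iff)
  then have "\<forall>n\<in>A'. \<not> int b dvd n - (r - k)"
    using assms(3) by (metis add_diff_eq diff_diff_eq2)
  then show "\<exists>r. \<forall>n\<in>A'. \<not> int b dvd n - r" by blast
qed

lemma singleton_admissible: "admissible_set B {a}"
  unfolding admissible_iff[OF order_refl]
proof
  fix b assume "b \<in> B"
  then have "\<not> int b dvd a - (a - 1)" using moduli_ge_2[of b] by (simp add: zdvd1_eq)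
  then show "\<exists>r. \<forall>n\<in>{a}. \<not> int b dvd n - r" by blast
qed

lemma mem_admissible_shift: "x \<in> admissible_shift B \<longleftrightarrow> admissible_set B {n. x n}"
  by (simp add: admissible_shift_def support_def)

end

section \<open>Finitely forced patterns and the embedding\<close>

lemma periodic_add_mult:
  fixes A :: "int set"
  assumes "\<And>n. n + N \<in> A \<longleftrightarrow> n \<in> A"
  shows "n + N * j \<in> A \<longleftrightarrow> n \<in> A"
proof (induction j rule: int_induct[of _ 0])
  case (step1 j)
  then show ?case using assms[of "n + N * j"] by (simp add: algebra_simps)
next
  case (step2 j)
  then show ?case using assms[of "n + N * (j - 1)"] by (simp add: algebra_simps)
qed simp

context moduli
begin

text \<open>
  A block consists of the header \<open>A \<inter> {0..t * N}\<close>, followed by zeros except for the data bits at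
  \<open>(t + 2) * N\<close> and \<open>(t + 3) * N\<close>, up to length \<open>(t + 5) * N\<close>. A header contains the arithmetic
  progression \<open>0, N, \<dots>, t * N\<close>. If it started inside an earlier block, this progression would hit one
  of the two windows of length \<open>N\<close> right after the header or at the end of that block, and both are
  zero. Hence blocks do not overlap.
  
  A sequence that contains a block at \<open>k\<close> lies inside the translate of \<open>A\<close> by \<open>k\<close>. All data positions
  of its blocks lie in that translate as well, because block positions do and the data offsets are
  multiples of \<open>N\<close>. So rewriting data bits keeps the sequence inside an admissible set.
\<close>

lemma embeds_if_periodic:
  fixes N t :: int and A :: "int set"
  assumes N: "N > 0" and t: "t \<ge> 3" and periodic: "\<forall>n. n + N \<in> A \<longleftrightarrow> n \<in> A"
    and "0 \<in> A" and adm: "admissible_set B A"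
    and force: "\<forall>D k. admissible_set B D \<longrightarrow> (\<forall>a\<in>A. 0 \<le> a \<longrightarrow> a \<le> t * N \<longrightarrow> a + k \<in> D) \<longrightarrow>
      (\<forall>n\<in>D. n - k \<in> A)"
  shows "\<exists>\<phi>. \<phi> \<in> mon (Aut UNIV) (Aut (admissible_shift B))"
proof -
  note per = periodic[THEN spec]
  define m where "m = (t + 5) * N"
  define p where "p = (\<lambda>s. if s then (t + 2) * N else (t + 3) * N)"
  define c where "c = (\<lambda>n. n \<in> A \<and> n \<le> t * N)"
  define occ where "occ = block_at m p c"
  note occ_def' = occ_def block_at_def
  have tN: "t * N \<ge> 3 * N" using N t by (intro mult_right_mono) auto
  note expand = m_def p_def algebra_simps
  have mult: "N * j \<in> A" for j
    using periodic_add_mult[OF per, where n = 0 and j = j] \<open>0 \<in> A\<close> by simp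
  have p_range: "p s \<in> {0..<m}" "p s > t * N" for s
    using N tN by (auto simp: expand)
  have header: "x (k + a)" if "occ x k" "a \<in> A" "0 \<le> a" "a \<le> t * N" for x k a
  proof -
    have "a \<in> {0..<m} - range p"
    proof -
      have "a \<noteq> p s" for s using that(4) p_range(2)[of s] by auto
      moreover have "a < m" using that(4) N by (simp add: expand)
      ultimately show ?thesis using that(3) by auto
    qed
    then show ?thesis using that by (auto simp: occ_def' c_def)
  qed
  have zero: "\<not> x (k + n)"
    if "occ x k" "t * N < n \<and> n \<le> t * N + N \<or> t * N + 4 * N \<le> n \<and> n < t * N + 5 * N" for x k n
  proof -
    have "0 \<le> n" using that(2) tN N by linarith
    then have "n \<in> {0..<m} - range p"
      using that(2) N by (auto simp: expand)
    then show ?thesis using that tN N by (auto simp: occ_def' c_def)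
  qed
  have confined: "n - k \<in> A" if "x \<in> admissible_shift B" "occ x k" "x n" for x k n
  proof (rule force[rule_format])
    show "admissible_set B {n. x n}" using that(1) by (simp add: mem_admissible_shift)
    show "a + k \<in> {n. x n}" if "a \<in> A" "0 \<le> a" "a \<le> t * N" for a
      using header[OF \<open>occ x k\<close> that] by (simp add: add.commute)
    show "n \<in> {n. x n}" using that(3) by simp
  qed
  have "conveyor (admissible_shift B) m p c"
  proof (unfold_locales, fold occ_def)
    show "subshift (admissible_shift B)" by (rule subshift_admissible_shift)
    show "p s \<in> {0..<m}" for s by (rule p_range)
    show "inj p" using N by (auto intro!: injI simp: p_def split: if_splits)
  next
    fix x k j assume k: "occ x k" and j: "occ x j" and "k < j"
    show "k + m \<le> j"
    proof (rule ccontr)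
      assume "\<not> k + m \<le> j"
      define d where "d = j - k"
      have d: "0 < d" "d < m" using \<open>k < j\<close> \<open>\<not> k + m \<le> j\<close> by (auto simp: d_def)
      have ones: "x (k + (d + N * i))" if "0 \<le> i" "i \<le> t" for i
      proof -
        have "N * i \<le> t * N" using that N by (simp add: mult.commute)
        then show ?thesis using header[OF j mult, of i] that N by (simp add: d_def)
      qed
      show False
      proof (cases "d \<le> (t + 1) * N")
        case True
        \<comment> \<open>The term \<open>d + N * (t - q)\<close> is the one in the window right after the header.\<close>
        obtain q r where qr: "d - 1 = N * q + r" "0 \<le> r" "r < N"
          using that[of "(d - 1) div N" "(d - 1) mod N"] N by simp
        have "q \<ge> 0"
        proof (rule ccontr)
          assume "\<not> q \<ge> 0"
          then have "N * q \<le> N * (- 1)" using N by (intro mult_left_mono) auto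
          then show False using d(1) qr by simp
        qed
        moreover have "q \<le> t"
        proof (rule ccontr)
          assume "\<not> q \<le> t"
          then have "N * (t + 1) \<le> N * q" using N by (intro mult_left_mono) auto
          then show False using True qr by (simp add: algebra_simps)
        qed
        ultimately have "x (k + (d + N * (t - q)))" by (intro ones) auto
        moreover have "t * N < d + N * (t - q) \<and> d + N * (t - q) \<le> t * N + N"
          using qr by (simp add: algebra_simps)
        ultimately show False using zero[OF k] by blast
      next
        case False
        \<comment> \<open>The term \<open>d + N * (t + 4 - q)\<close> is the one in the window at the end of the block.\<close>
        obtain q r where qr: "d = N * q + r" "0 \<le> r" "r < N"
          using that[of "d div N" "d mod N"] N by simp
        have "q \<le> t + 4"
        proof (rule ccontr)
          assume "\<not> q \<le> t + 4"
          then have "N * (t + 5) \<le> N * q" using N by (intro mult_left_mono) auto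
          then show False using d(2) qr by (simp add: m_def algebra_simps)
        qed
        moreover have "q \<ge> t + 1"
        proof (rule ccontr)
          assume "\<not> q \<ge> t + 1"
          then have "N * q \<le> N * t" using N by (intro mult_left_mono) auto
          moreover have "(t + 1) * N = N * t + N" by (simp add: algebra_simps)
          ultimately show False using False qr by linarith
        qed
        ultimately have "x (k + (d + N * (t + 4 - q)))" using t by (intro ones) auto
        moreover have "t * N + 4 * N \<le> d + N * (t + 4 - q) \<and> d + N * (t + 4 - q) < t * N + 5 * N"
          using qr by (simp add: algebra_simps)
        ultimately show False using zero[OF k] by blast
      qed
    qed
  next
    fix x y :: "int \<Rightarrow> bool"
    assume x: "x \<in> admissible_shift B" and y: "\<And>n. y n \<noteq> x n \<Longrightarrow> \<exists>k s. occ x k \<and> n = k + p s"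
    show "y \<in> admissible_shift B"
    proof (cases "\<exists>k. occ x k")
      case False
      then have "y = x" using y by blast
      then show ?thesis using x by simp
    next
      case True
      then obtain k where k: "occ x k" by blast
      have "n - k \<in> A" if yn: "y n" for n
      proof (cases "x n")
        case True
        then show ?thesis by (rule confined[OF x k])
      next
        case False
        then obtain j s where j: "occ x j" "n = j + p s" using y yn by blast
        have "x (j + 0)" using header[OF j(1) \<open>0 \<in> A\<close>] N t by simp
        then have "j - k \<in> A" using confined[OF x k] by simp
        moreover have "n - k = (j - k) + N * (if s then t + 2 else t + 3)"
          by (simp add: j(2) p_def algebra_simps)
        ultimately show ?thesis using periodic_add_mult[OF per] by metis
      qed
      then have "admissible_set B {n. y n}"
        by (intro admissible_translate[OF order_refl adm, where k = "- k"]) auto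
      then show ?thesis by (simp add: mem_admissible_shift)
    qed
  next
    fix z :: "int \<Rightarrow> bool"
    \<comment> \<open>Blocks everywhere, with \<open>z\<close> on the upper track and zeros on the lower one.\<close>
    define x where "x = (\<lambda>n. c (n mod m) \<or> n mod m = p True \<and> z (n div m))"
    have "m > 0" using p_range(1)[of True] by auto
    have in_block: "x (m * i + n) = (c n \<or> n = p True \<and> z i)" if "n \<in> {0..<m}" for i n
      using that \<open>m > 0\<close> by (simp add: x_def)
    have "n \<in> A" if "x n" for n
    proof -
      have "p True = N * (t + 2)" by (simp add: p_def)
      then have "n mod m \<in> A" using that mult by (auto simp: x_def c_def)
      moreover have "n = n mod m + N * ((t + 5) * (n div m))"
        by (metis m_def mod_mult_div_eq mult.assoc mult.commute)
      ultimately show ?thesis using periodic_add_mult[OF per] by metis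
    qed
    then have "x \<in> admissible_shift B"
      using admissible_mono[OF order_refl adm, of "{n. x n}"] by (auto simp: mem_admissible_shift)
    moreover have "occ x (m * i) \<and> x (m * i + p True) = z i" for i
      using p_range[of True] by (auto simp: occ_def' in_block c_def)
    ultimately show "\<exists>x\<in>admissible_shift B. \<forall>i. occ x (m * i) \<and> x (m * i + p True) = z i"
      by blast
  qed
  then show ?thesis using conveyor.Aut_full_shift_embeds by blast
qed

text \<open>
  Residues modulo \<open>N\<close>, the product of \<open>B0\<close>, decide \<open>B0\<close>-admissibility. Among the residue sets modulo
  \<open>N\<close> of \<open>B0\<close>-admissible sets that contain \<open>W\<close>, choose a maximal one and let \<open>A\<close> be its preimage.
  A finite part of \<open>A\<close> that contains \<open>W\<close> and meets all these residues forces: an admissible set that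
  contains this part has at least the residues of \<open>A\<close>, hence no others. A translation puts the
  origin into \<open>A\<close> and to the left of \<open>W\<close>.
\<close>

lemma periodic_if_finitely_forced:
  assumes W: "finite W" "admissible_set B W" and B0: "finite B0" "B0 \<subseteq> B"
    and enough: "\<forall>D. W \<subseteq> D \<longrightarrow> admissible_set B0 D \<longrightarrow> admissible_set B D"
  obtains N t :: int and A :: "int set" where "N > 0" "t \<ge> 3" "\<forall>n. n + N \<in> A \<longleftrightarrow> n \<in> A" "0 \<in> A"
    "admissible_set B A"
    "\<forall>D k. admissible_set B D \<longrightarrow> (\<forall>a\<in>A. 0 \<le> a \<longrightarrow> a \<le> t * N \<longrightarrow> a + k \<in> D) \<longrightarrow>
      (\<forall>n\<in>D. n - k \<in> A)"
proof -
  define N where "N = int (\<Prod>B0)"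
  have N: "N > 0"
    using moduli_ge_2 B0(2) unfolding N_def by (fastforce intro!: prod_pos)
  have dvd_N: "int b dvd N" if "b \<in> B0" for b
    unfolding N_def int_dvd_int_iff using dvd_prodI[OF B0(1) that, of id] by simp
  define \<R> where "\<R> = (\<lambda>D. (\<lambda>n. n mod N) ` D) ` {D. W \<subseteq> D \<and> admissible_set B0 D}"
  have W0: "admissible_set B0 D" if "admissible_set B D" for D
    using that B0(2) by (auto simp: admissible_set_def)
  have "\<R> \<subseteq> Pow {0..<N}" using N by (auto simp: \<R>_def)
  then have "finite \<R>" by (rule finite_subset) simp
  moreover have "\<R> \<noteq> {}" using W0[OF W(2)] by (auto simp: \<R>_def)
  ultimately obtain R where R: "R \<in> \<R>" "\<And>R'. R' \<in> \<R> \<Longrightarrow> R \<subseteq> R' \<Longrightarrow> R = R'"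
    by (meson finite_has_maximal)
  then obtain D where D: "W \<subseteq> D" "admissible_set B0 D" "R = (\<lambda>n. n mod N) ` D"
    by (auto simp: \<R>_def)
  define A where "A = {n. n mod N \<in> R}"
  have "W \<subseteq> A" using D by (auto simp: A_def)
  have "admissible_set B0 A"
    unfolding admissible_iff[OF B0(2)]
  proof
    fix b assume b: "b \<in> B0"
    then obtain r where r: "\<forall>n\<in>D. \<not> int b dvd n - r"
      using admissibleE[OF D(2) _ B0(2)] by blast
    have "\<not> int b dvd n - r" if "n \<in> A" for n
    proof -
      have "n mod N \<in> (\<lambda>n. n mod N) ` D" using that by (simp add: A_def flip: D(3))
      then obtain n' where n': "n' \<in> D" "n mod N = n' mod N" by blast
      then have "int b dvd n - n'" using dvd_N[OF b] by (meson dvd_trans mod_eq_dvd_iff)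
      then have "int b dvd (n - r) - (n' - r)" by simp
      then show ?thesis using r n'(1) dvd_diff_commute[of "int b"]
        by (metis (no_types, lifting) diff_diff_eq2 diff_add_cancel dvd_add_right_iff)
    qed
    then show "\<exists>r. \<forall>n\<in>A. \<not> int b dvd n - r" by blast
  qed
  then have adm: "admissible_set B A" using enough \<open>W \<subseteq> A\<close> by blast
  have maximal: "D' \<subseteq> A"
    if "W \<subseteq> D'" "admissible_set B D'" "R \<subseteq> (\<lambda>n. n mod N) ` D'" for D'
  proof -
    have "(\<lambda>n. n mod N) ` D' \<in> \<R>" using that W0 by (auto simp: \<R>_def)
    then have "R = (\<lambda>n. n mod N) ` D'" using R(2) that(3) by blast
    then show ?thesis by (auto simp: A_def)
  qed
  have "A \<noteq> {}"
  proof
    assume "A = {}"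
    then have "W = {}" "R = {}" using \<open>W \<subseteq> A\<close> D by (auto simp: A_def)
    then have "{0} \<subseteq> A" using maximal[of "{0}"] singleton_admissible by auto
    then show False using \<open>A = {}\<close> by simp
  qed
  then obtain a0 where "a0 \<in> A" by blast
  have per: "n + N \<in> A \<longleftrightarrow> n \<in> A" for n by (simp add: A_def)
  define l where "l = Min (insert a0 W)"
  define a where "a = a0 + N * (- (a0 - l))"
  have "l \<le> a0" using W(1) by (simp add: l_def)
  then have "1 * (a0 - l) \<le> N * (a0 - l)" using N by (intro mult_right_mono) auto
  moreover have "a = a0 - N * (a0 - l)" by (simp add: a_def algebra_simps)
  ultimately have "a \<le> l" by simp
  moreover have "l \<le> w" if "w \<in> W" for w using W(1) that by (simp add: l_def)
  ultimately have a_W: "a \<le> w" if "w \<in> W" for w using that by force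
  have "a \<in> A" using \<open>a0 \<in> A\<close> periodic_add_mult[OF per] by (simp add: a_def)
  \<comment> \<open>Since \<open>N\<close> is at least 1, this makes \<open>{a..a + t * N}\<close> contain \<open>W\<close> and a full period.\<close>
  define t where "t = 3 + (Max (insert a W) - a)"
  have "a \<le> Max (insert a W)" using W(1) by simp
  then have t: "t \<ge> 3" by (simp add: t_def)
  have tN: "t * N \<ge> t" "t * N \<ge> N" using t N by auto
  have W_t: "w - a \<le> t * N" if "w \<in> W" for w
  proof -
    have "w \<le> Max (insert a W)" using W(1) that by simp
    then show ?thesis using tN(1) unfolding t_def by linarith
  qed
  show ?thesis
  proof (rule that[of N t "{n. n + a \<in> A}"])
    show "\<forall>n. n + N \<in> {n. n + a \<in> A} \<longleftrightarrow> n \<in> {n. n + a \<in> A}"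
    proof
      fix n show "n + N \<in> {n. n + a \<in> A} \<longleftrightarrow> n \<in> {n. n + a \<in> A}"
        using per[of "n + a"] by (simp add: ac_simps)
    qed
    show "0 \<in> {n. n + a \<in> A}" using \<open>a \<in> A\<close> by simp
    show "admissible_set B {n. n + a \<in> A}"
      by (rule admissible_translate[OF order_refl adm, of _ a]) simp
  next
    show "\<forall>D k. admissible_set B D \<longrightarrow>
      (\<forall>c\<in>{n. n + a \<in> A}. 0 \<le> c \<longrightarrow> c \<le> t * N \<longrightarrow> c + k \<in> D) \<longrightarrow>
      (\<forall>n\<in>D. n - k \<in> {n. n + a \<in> A})"
    proof (intro allI impI ballI)
      fix D k n
      assume D: "admissible_set B D" "n \<in> D"
        and header: "\<forall>c\<in>{n. n + a \<in> A}. 0 \<le> c \<longrightarrow> c \<le> t * N \<longrightarrow> c + k \<in> D"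
      define D' where "D' = {n. n + (k - a) \<in> D}"
      have "W \<subseteq> D'"
      proof
        fix w assume "w \<in> W"
        then have "(w - a) + k \<in> D" using a_W W_t \<open>W \<subseteq> A\<close> by (intro header[rule_format]) auto
        then show "w \<in> D'" by (simp add: D'_def algebra_simps)
      qed
      moreover have "admissible_set B D'"
        by (rule admissible_translate[OF order_refl D(1)]) (simp add: D'_def)
      moreover have "R \<subseteq> (\<lambda>n. n mod N) ` D'"
      proof
        fix r assume r: "r \<in> R"
        then have "r mod N = r" using D(1) \<open>\<R> \<subseteq> Pow {0..<N}\<close> R(1) by (force intro: mod_pos_pos_trivial)
        define c where "c = (r - a) mod N"
        have "(c + a) mod N = r" using \<open>r mod N = r\<close> by (simp add: c_def mod_add_left_eq)
        moreover have "c \<ge> 0" "c < N" using N by (simp_all add: c_def)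
        moreover have "c \<le> t * N" using \<open>c < N\<close> tN(2) by linarith
        ultimately have "c + k \<in> D" using r by (intro header[rule_format]) (auto simp: A_def)
        then have "c + a \<in> D'" by (simp add: D'_def algebra_simps)
        then show "r \<in> (\<lambda>n. n mod N) ` D'" using \<open>(c + a) mod N = r\<close> by (metis imageI)
      qed
      ultimately have "D' \<subseteq> A" by (rule maximal)
      moreover have "n - k + a \<in> D'" using D(2) by (simp add: D'_def)
      ultimately show "n - k \<in> {n. n + a \<in> A}" by auto
    qed
  qed (use N t in auto)
qed

end

section \<open>Rigidity when nothing is finitely forced\<close>

text \<open>
  Every class modulo \<open>K\<close> is infinite, so representatives can be chosen one after the other, avoiding
  the finitely many forbidden places.
\<close>

lemma sparse_representatives:
  fixes F E D :: "int set" and K :: int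
  assumes "finite F" "finite E" "finite D" "K \<noteq> 0"
  shows "\<exists>G. finite G \<and> card G \<le> card F \<and> G \<inter> E = {} \<and>
    (\<forall>g\<in>G. \<forall>g'\<in>G. g \<noteq> g' \<longrightarrow> g' - g \<notin> D) \<and>
    (\<forall>g\<in>G. \<exists>f\<in>F. K dvd g - f) \<and> (\<forall>f\<in>F. \<exists>g\<in>G. K dvd g - f)"
  using assms(1)
proof (induction F rule: finite_induct)
  case empty
  show ?case by (rule exI[of _ "{}"]) simp
next
  case (insert f F)
  then obtain G where G: "finite G" "card G \<le> card F" "G \<inter> E = {}"
    "\<forall>g\<in>G. \<forall>g'\<in>G. g \<noteq> g' \<longrightarrow> g' - g \<notin> D"
    "\<forall>g\<in>G. \<exists>f\<in>F. K dvd g - f" "\<forall>f\<in>F. \<exists>g\<in>G. K dvd g - f" by (elim exE conjE)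
  define E' where "E' = E \<union> (\<Union>g\<in>G. (\<lambda>d. g + d) ` D \<union> (\<lambda>d. g - d) ` D)"
  have "inj (\<lambda>i. f + K * i)" using \<open>K \<noteq> 0\<close> by (auto intro: injI)
  then have "infinite (range (\<lambda>i. f + K * i))" by (simp add: finite_image_iff infinite_UNIV_int)
  moreover have "finite E'" using G(1) assms(2,3) by (simp add: E'_def)
  ultimately obtain i where "f + K * i \<notin> E'" by (meson finite_subset image_subsetI)
  then obtain z where z: "K dvd z - f" "z \<notin> E'" by force
  have "g - z \<notin> D \<and> z - g \<notin> D" if "g \<in> G" for g
  proof -
    have "z \<noteq> g + d \<and> z \<noteq> g - d" if "d \<in> D" for d
      using z(2) \<open>g \<in> G\<close> that by (auto simp: E'_def)
    from this[of "z - g"] this[of "g - z"] show ?thesis by auto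
  qed
  moreover have "z \<notin> E" using z(2) by (simp add: E'_def)
  moreover have "card (insert z G) \<le> card (insert f F)"
    using G(1,2) insert.hyps by (simp add: card_insert_if)
  ultimately show ?case
    using G z(1) by (intro exI[of _ "insert z G"]) auto
qed

text \<open>
  By continuity, a finite window around \<open>0\<close> decides that the image of the single point \<open>0\<close> contains
  \<open>s\<close>. A point \<open>g\<close> that is isolated in \<open>y\<close> in this sense therefore contributes \<open>g + s\<close>.
\<close>

lemma isolated_point_image:
  assumes X: "subshift X" and \<phi>: "\<phi> \<in> carrier (Aut X)" and pt: "(\<lambda>n. n = 0) \<in> X"
    and s: "\<phi> (\<lambda>n. n = 0) s"
  obtains T where "finite T"
    "\<forall>y\<in>X. \<forall>g. (\<forall>t\<in>T. y (g + t) \<longleftrightarrow> t = 0) \<longrightarrow> \<phi> y (g + s)"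
proof -
  have im: "shift ` X = X" using X by (simp add: subshift_def)
  obtain T where T: "finite T"
    "\<forall>y\<in>X. (\<forall>t\<in>T. y t = (t = 0)) \<longrightarrow> \<phi> y s = \<phi> (\<lambda>n. n = 0) s"
    using bspec[OF spec[OF iffD1[OF continuous_on_sequences_iff Aut_continuous[OF \<phi>]], of s] pt]
    by (elim exE conjE)
  have image: "\<phi> y (g + s)" if "y \<in> X" "\<forall>t\<in>T. y (g + t) \<longleftrightarrow> t = 0" for y g
  proof -
    have "\<phi> (\<lambda>n. y (n + g)) s"
      using T(2) translate_mem[OF im that(1), of g] that(2) s by (simp add: add.commute)
    then show ?thesis by (simp add: Aut_translate[OF X \<phi> that(1)] add.commute)
  qed
  show ?thesis by (rule that[OF T(1)], intro ballI allI impI) (rule image)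
qed

context moduli
begin

text \<open>
  A modulus that is larger than the number of points is never an obstruction. So the residues of
  \<open>F\<close> only need to be preserved for the moduli up to \<open>l\<close>, and these all divide \<open>fact l\<close>.
\<close>

lemma sparse_copy:
  assumes F: "finite F" "admissible_set B F" "W \<subseteq> F" and E: "finite E" "finite D" and b: "b \<in> B"
  obtains G where "finite G" "G \<inter> E = {}" "\<forall>g\<in>G. \<forall>g'\<in>G. g \<noteq> g' \<longrightarrow> g' - g \<notin> D"
    "admissible_set B (W \<union> G)" "\<forall>f\<in>F. \<exists>g\<in>G. int b dvd g - f"
proof -
  define l where "l = b + 2 * card F"
  define K where "K = (fact l :: int)"
  have dvd_K: "int b' dvd K" if "b' \<in> B" "b' \<le> l" for b'
  proof -
    have "b' dvd fact l" using that moduli_ge_2[of b'] by (intro dvd_fact) auto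
    then show ?thesis unfolding K_def by (metis int_dvd_int_iff of_nat_fact)
  qed
  obtain G where G: "finite G" "card G \<le> card F" "G \<inter> E = {}"
    "\<forall>g\<in>G. \<forall>g'\<in>G. g \<noteq> g' \<longrightarrow> g' - g \<notin> D"
    "\<forall>g\<in>G. \<exists>f\<in>F. K dvd g - f" "\<forall>f\<in>F. \<exists>g\<in>G. K dvd g - f"
    using sparse_representatives[OF F(1) E, of K] by (auto simp: K_def)
  have missing: "\<exists>r. \<forall>n\<in>W \<union> G. \<not> int b' dvd n - r" if b': "b' \<in> B" for b'
  proof (cases "b' \<le> l")
    case True
    obtain r where r: "\<forall>n\<in>F. \<not> int b' dvd n - r"
      using F(2) b' order_refl by (rule admissibleE)
    have "\<not> int b' dvd g - r" if g: "g \<in> G" for g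
    proof
      assume dvd: "int b' dvd g - r"
      obtain f where f: "f \<in> F" "K dvd g - f" using G(5) g by blast
      have "int b' dvd g - f" using dvd_K[OF b' True] f(2) by (rule dvd_trans)
      with dvd have "int b' dvd (g - r) - (g - f)" by (rule dvd_diff)
      then show False using r f(1) by simp
    qed
    then show ?thesis using r F(3) by blast
  next
    case False
    have "card ((\<lambda>n. n mod int b') ` (W \<union> G)) \<le> card (W \<union> G)"
      using G(1) F(1,3) by (intro card_image_le) (auto intro: finite_subset)
    also have "\<dots> \<le> card W + card G" by (rule card_Un_le)
    also have "\<dots> \<le> 2 * card F" using card_mono[OF F(1,3)] G(2) by simp
    also have "\<dots> < b'" using False by (simp add: l_def)
    finally show ?thesis using card_residues_less_iff[of b'] moduli_ge_2[OF b'] by simp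
  qed
  have "admissible_set B (W \<union> G)"
    using missing by (simp add: admissible_iff[OF order_refl])
  moreover have "int b dvd K" using dvd_K[OF b] by (simp add: l_def)
  then have "\<forall>f\<in>F. \<exists>g\<in>G. int b dvd g - f" using G(6) by (meson dvd_trans)
  ultimately show ?thesis using G(1,3,4) by (intro that)
qed

end

text \<open>
  No finite pattern reduces admissibility to finitely many moduli: every finite admissible pattern
  extends to a set that respects any prescribed finite part of \<open>B\<close> but violates another modulus.
\<close>

locale not_finitely_forced = moduli +
  assumes escape: "\<And>W B0. \<lbrakk>finite W; admissible_set B W; finite B0; B0 \<subseteq> B\<rbrakk>
    \<Longrightarrow> \<exists>D. W \<subseteq> D \<and> admissible_set B0 D \<and> \<not> admissible_set B D"
begin

text \<open>
  Extend \<open>W\<close> to a set \<open>D\<close> that is admissible for all small moduli but not for all of \<open>B\<close>, and let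
  \<open>b\<close> be the least modulus that \<open>D\<close> violates. Being large, \<open>b\<close> separates the points of \<open>W \<union> {p}\<close>.
  Add to \<open>W\<close> one point of \<open>D\<close> for each class modulo \<open>b\<close> that \<open>W \<union> {p}\<close> does not meet. The result \<open>F\<close>
  has at most \<open>b - 1\<close> points, so it is admissible for every modulus above \<open>b\<close>; it misses the class of
  \<open>p\<close> modulo \<open>b\<close>; and below \<open>b\<close> it is admissible as a subset of \<open>D\<close>.
\<close>

lemma saturate:
  assumes W: "finite W" "admissible_set B W" and p: "p \<notin> W"
  obtains b F where "b \<in> B" "finite F" "W \<subseteq> F" "admissible_set B F"
    "\<forall>r. \<not> int b dvd r - p \<longrightarrow> (\<exists>f\<in>F. int b dvd f - r)"
proof -
  \<comment> \<open>A bound for all distances in \<open>W \<union> {p}\<close>: points of it that agree modulo some \<open>b > l\<close> are equal.\<close>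
  define l where "l = Max ((\<lambda>w. nat \<bar>w - p\<bar>) ` W \<union> (\<lambda>(u, v). nat \<bar>u - v\<bar>) ` (W \<times> W) \<union> {0})"
  have l: "nat \<bar>w - p\<bar> \<le> l" if "w \<in> W" for w
    unfolding l_def using W(1) that by (intro Max_ge) auto
  have l': "nat \<bar>u - v\<bar> \<le> l" if "u \<in> W" "v \<in> W" for u v
    unfolding l_def using W(1) that by (intro Max_ge) auto
  have small: "n = 0" if "int b dvd n" "nat \<bar>n\<bar> \<le> l" "b > l" for b n
  proof (rule ccontr)
    assume "n \<noteq> 0"
    then have "int b \<le> \<bar>n\<bar>" using dvd_imp_le_int[OF _ that(1)] by simp
    then show False using that(2,3) by linarith
  qed
  have "finite {b \<in> B. b \<le> l}" by (rule finite_subset[of _ "{..l}"]) auto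
  then obtain D where D: "W \<subseteq> D" "admissible_set {b \<in> B. b \<le> l} D" "\<not> admissible_set B D"
    using escape[OF W, of "{b \<in> B. b \<le> l}"] by auto
  define full where "full b \<longleftrightarrow> b \<in> B \<and> (\<forall>r. \<exists>n\<in>D. int b dvd n - r)" for b
  define b where "b = (LEAST b. full b)"
  have "\<exists>b. full b" using D(3) by (auto simp: admissible_iff[OF order_refl] full_def)
  then have "full b" unfolding b_def by (rule LeastI_ex)
  then have b: "b \<in> B" and hit: "\<exists>n\<in>D. int b dvd n - r" for r by (auto simp: full_def)
  have least: "\<exists>r. \<forall>n\<in>D. \<not> int b' dvd n - r" if "b' \<in> B" "b' < b" for b'
    using not_less_Least[of b' full] that by (auto simp: b_def full_def)
  have "b > l"
  proof (rule ccontr)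
    assume "\<not> b > l"
    then have "b \<in> {b \<in> B. b \<le> l}" using b by simp
    from admissibleE[OF D(2) this] obtain r where "\<forall>n\<in>D. \<not> int b dvd n - r" by auto
    then show False using hit[of r] by blast
  qed
  have "b > 0" using \<open>b > l\<close> by simp
  obtain g where g: "\<And>r. g r \<in> D" "\<And>r. int b dvd g r - r" using hit by metis
  let ?res = "\<lambda>n. n mod int b"
  define C where "C = {0..<int b} - ?res ` insert p W"
  define F where "F = W \<union> g ` C"
  have "finite C" by (simp add: C_def)
  then have "finite F" using W(1) by (simp add: F_def)
  have "F \<subseteq> D" using D(1) g(1) by (auto simp: F_def)
  have "card F < b"
  proof -
    have "inj_on ?res (insert p W)"
    proof (rule inj_onI)
      fix u v assume uv: "u \<in> insert p W" "v \<in> insert p W" and "?res u = ?res v"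
      then have "int b dvd u - v" by (simp add: mod_eq_dvd_iff)
      moreover have "nat \<bar>u - v\<bar> \<le> l"
        using uv l[of u] l[of v] l'[of u v] by (auto simp: abs_minus_commute)
      ultimately show "u = v" using small \<open>b > l\<close> by fastforce
    qed
    then have "card (?res ` insert p W) = Suc (card W)"
      using W(1) p by (subst card_image) auto
    moreover have "?res ` insert p W \<subseteq> {0..<int b}" using \<open>b > 0\<close> by auto
    then have "card C = b - card (?res ` insert p W)"
      and "card (?res ` insert p W) \<le> b"
      using card_mono[of "{0..<int b}" "?res ` insert p W"]
      by (auto simp: C_def card_Diff_subset finite_subset)
    moreover have "card F \<le> card W + card C"
      unfolding F_def using card_Un_le card_image_le[OF \<open>finite C\<close>] by (meson add_left_mono le_trans)
    ultimately show ?thesis by linarith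
  qed
  have "\<exists>r. \<forall>n\<in>F. \<not> int b' dvd n - r" if b': "b' \<in> B" for b'
  proof (cases b' b rule: linorder_cases)
    case less
    then show ?thesis using least[OF b'] \<open>F \<subseteq> D\<close> by blast
  next
    case equal
    have "\<not> int b dvd n - p" if n: "n \<in> F" for n
    proof
      assume dvd: "int b dvd n - p"
      show False
      proof (cases "n \<in> W")
        case True
        then show False using small[OF dvd l \<open>b > l\<close>] p by auto
      next
        case False
        then obtain r where r: "r \<in> C" "n = g r" using n by (auto simp: F_def)
        have "int b dvd (n - p) - (g r - r)" using dvd g(2) by (rule dvd_diff)
        then have "?res r = ?res p" by (simp add: r(2) mod_eq_dvd_iff)
        then show False using r(1) by (auto simp: C_def)
      qed
    qed
    then show ?thesis using equal by blast
  next
    case greater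
    have "card ((\<lambda>n. n mod int b') ` F) < b'"
      using card_image_le[OF \<open>finite F\<close>, of "\<lambda>n. n mod int b'"] \<open>card F < b\<close> greater by linarith
    then show ?thesis using card_residues_less_iff[of b' F] greater by simp
  qed
  then have adm: "admissible_set B F" by (simp add: admissible_iff[OF order_refl])
  have hits: "\<exists>f\<in>F. int b dvd f - r" if r: "\<not> int b dvd r - p" for r
  proof (cases "?res r \<in> ?res ` W")
    case True
    then show ?thesis by (auto simp: F_def mod_eq_dvd_iff dvd_diff_commute)
  next
    case False
    then have "?res r \<in> C" using \<open>b > 0\<close> r by (auto simp: C_def mod_eq_dvd_iff)
    moreover have "?res (g (?res r)) = ?res (?res r)"
      using g(2)[of "?res r"] by (simp only: mod_eq_dvd_iff)
    then have "int b dvd g (?res r) - r" by (simp add: mod_eq_dvd_iff[symmetric])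
    ultimately show ?thesis by (auto simp: F_def)
  qed
  have "W \<subseteq> F" by (simp add: F_def)
  show ?thesis
    by (rule that[OF b \<open>finite F\<close> \<open>W \<subseteq> F\<close> adm], intro allI impI) (rule hits)
qed

text \<open>
  Otherwise the image of a suitable admissible set would meet every class modulo some \<open>b \<in> B\<close>: the
  copy \<open>G\<close> of the saturated set contributes all classes but one, translated by \<open>s\<close>, and \<open>q + s\<close>
  contributes the last one.
\<close>

lemma image_in_translate:
  assumes \<phi>: "\<phi> \<in> carrier (Aut (admissible_shift B))" and s: "\<phi> (\<lambda>n. n = 0) s"
    and x: "x \<in> admissible_shift B" and q: "\<phi> x (q + s)"
  shows "x q"
proof (rule ccontr)
  assume "\<not> x q"
  let ?X = "admissible_shift B"
  have pt: "(\<lambda>n. n = 0) \<in> ?X"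
    using singleton_admissible[of 0] by (simp add: mem_admissible_shift)
  obtain T where T: "finite T"
    "\<forall>y\<in>?X. \<forall>g. (\<forall>t\<in>T. y (g + t) \<longleftrightarrow> t = 0) \<longrightarrow> \<phi> y (g + s)"
    by (rule isolated_point_image[OF subshift_admissible_shift \<phi> pt s])
  obtain S where S: "finite S" "\<forall>y\<in>?X. (\<forall>i\<in>S. y i = x i) \<longrightarrow> \<phi> y (q + s) = \<phi> x (q + s)"
    using bspec[OF spec[OF iffD1[OF continuous_on_sequences_iff Aut_continuous[OF \<phi>]], of "q + s"] x]
    by (elim exE conjE)
  define W where "W = {n \<in> S. x n}"
  have W: "finite W" "admissible_set B W"
    using S(1) x admissible_mono[OF order_refl, of "{n. x n}" W]
    by (auto simp: W_def mem_admissible_shift)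
  have "q \<notin> W" using \<open>\<not> x q\<close> by (simp add: W_def)
  obtain b F where F: "b \<in> B" "finite F" "W \<subseteq> F" "admissible_set B F"
    "\<forall>r. \<not> int b dvd r - q \<longrightarrow> (\<exists>f\<in>F. int b dvd f - r)"
    by (rule saturate[OF W \<open>q \<notin> W\<close>])
  \<comment> \<open>Avoiding \<open>S\<close> keeps \<open>W \<union> G\<close> equal to \<open>x\<close> there; avoiding the differences keeps \<open>W\<close> out of the
    windows around the points of \<open>G\<close>.\<close>
  define E where "E = S \<union> (\<lambda>(w, t). w - t) ` (W \<times> T)"
  have "finite E" using S(1) T(1) W(1) by (simp add: E_def)
  obtain G where G: "finite G" "G \<inter> E = {}"
    "\<forall>g\<in>G. \<forall>g'\<in>G. g \<noteq> g' \<longrightarrow> g' - g \<notin> T"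
    "admissible_set B (W \<union> G)" "\<forall>f\<in>F. \<exists>g\<in>G. int b dvd g - f"
    by (rule sparse_copy[OF F(2,4,3) \<open>finite E\<close> T(1) F(1)])
  define y where "y = (\<lambda>n. n \<in> W \<union> G)"
  have y: "y \<in> ?X" using G(4) by (simp add: mem_admissible_shift y_def Collect_mem_eq del: Un_iff)
  have q_y: "\<phi> y (q + s)"
  proof -
    have "y i = x i" if "i \<in> S" for i
    proof -
      have "i \<notin> G" using that G(2) by (auto simp: E_def)
      then show ?thesis using that by (simp add: y_def W_def)
    qed
    then show ?thesis using S(2) y q by blast
  qed
  have g_y: "\<phi> y (g + s)" if "g \<in> G" for g
  proof (rule T(2)[rule_format, OF y])
    fix t assume t: "t \<in> T"
    show "y (g + t) \<longleftrightarrow> t = 0"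
    proof
      assume "y (g + t)"
      show "t = 0"
      proof (cases "g + t \<in> W")
        case True
        then have "(g + t) - t \<in> E" using t by (auto simp: E_def intro!: image_eqI[of _ _ "(g + t, t)"])
        then show ?thesis using that G(2) by auto
      next
        case False
        then have "g + t \<in> G" using \<open>y (g + t)\<close> by (simp add: y_def)
        then show ?thesis using G(3)[rule_format, OF that, of "g + t"] t by auto
      qed
    qed (use that in \<open>simp add: y_def\<close>)
  qed
  have "admissible_set B {n. \<phi> y n}" using Aut_image[OF \<phi> y] by (simp add: mem_admissible_shift)
  then obtain r where "\<forall>n\<in>{n. \<phi> y n}. \<not> int b dvd n - r"
    using F(1) order_refl by (rule admissibleE)
  then have r: "\<not> int b dvd n - r" if "\<phi> y n" for n using that by simp
  show False
  proof (cases "int b dvd (r - s) - q")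
    case True
    then show False using r[OF q_y] by (simp add: dvd_diff_commute algebra_simps)
  next
    case False
    then obtain f g where fg: "f \<in> F" "int b dvd f - (r - s)" "g \<in> G" "int b dvd g - f"
      using F(5) G(5) by blast
    have "int b dvd (g - f) + (f - (r - s))" using fg(4,2) by (rule dvd_add)
    then show False using r[OF g_y[OF \<open>g \<in> G\<close>]] by (simp add: algebra_simps)
  qed
qed

text \<open>
  The zero sequence is fixed, since its image is constant and the constant sequence \<open>1\<close> is not
  admissible. Hence the image of a single point is not zero, and \<open>image_in_translate\<close> applies both to
  \<open>\<phi>\<close> and to its inverse.
\<close>

lemma Aut_is_shift_power:
  assumes \<phi>: "\<phi> \<in> carrier (Aut (admissible_shift B))"
  shows "\<exists>k. \<forall>x\<in>admissible_shift B. \<phi> x = (\<lambda>n. x (n + k))"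
proof -
  let ?X = "admissible_shift B"
  note X = subshift_admissible_shift[of B]
  interpret group "Aut ?X" by (rule group_Aut[OF X])
  define pt where "pt = (\<lambda>n::int. n = 0)"
  define zero where "zero = (\<lambda>n::int. False)"
  have pt: "pt \<in> ?X"
    using singleton_admissible[of 0] by (simp add: mem_admissible_shift pt_def)
  have zero: "zero \<in> ?X"
    using admissible_mono[OF order_refl singleton_admissible] by (simp add: mem_admissible_shift zero_def)
  have const: "\<phi> zero n = \<phi> zero 0" for n
    using fun_cong[OF Aut_translate[OF X \<phi> zero, of n], of 0] by (simp add: zero_def)
  have "\<not> \<phi> zero 0"
  proof
    assume "\<phi> zero 0"
    then have "admissible_set B UNIV"
      using Aut_image[OF \<phi> zero] const by (simp add: mem_admissible_shift)
    then have "admissible_set B D" for D using admissible_mono[OF order_refl] by blast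
    then show False using escape[of "{}" "{}"] by auto
  qed
  then have "\<phi> zero = zero" using const by (auto simp: zero_def)
  moreover have "inj_on \<phi> ?X" using \<phi> by (auto simp: Aut_carrier Bij_def bij_betw_def)
  moreover have "pt \<noteq> zero" by (auto simp: pt_def zero_def fun_eq_iff)
  ultimately have "\<phi> pt \<noteq> zero" using pt zero by (metis inj_onD)
  then obtain s where s: "\<phi> pt s" by (auto simp: zero_def)
  have le: "x q" if "x \<in> ?X" "\<phi> x (q + s)" for x q
    using image_in_translate[OF \<phi> s[unfolded pt_def]] that by blast
  have \<phi>_pt: "\<phi> pt = (\<lambda>n. n = s)"
  proof
    fix n show "\<phi> pt n = (n = s)" using le[OF pt, of "n - s"] s by (auto simp: pt_def)
  qed
  define \<psi> where "\<psi> = inv\<^bsub>Aut ?X\<^esub> \<phi>"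
  have \<psi>: "\<psi> \<in> carrier (Aut ?X)" using \<phi> by (simp add: \<psi>_def)
  have "compose ?X \<psi> \<phi> = (\<lambda>x\<in>?X. x)"
    using l_inv[OF \<phi>] by (simp add: Aut_mult[OF \<psi> \<phi>] Aut_one flip: \<psi>_def)
  then have \<psi>\<phi>: "\<psi> (\<phi> x) = x" if "x \<in> ?X" for x
    using that by (metis compose_eq restrict_apply')
  have pt_s: "(\<lambda>n. pt (n + s)) \<in> ?X"
    using translate_mem[of ?X pt s] pt X by (simp add: subshift_def)
  have "\<phi> (\<lambda>n. pt (n + s)) = pt"
    unfolding Aut_translate[OF X \<phi> pt] \<phi>_pt by (simp add: pt_def)
  then have "\<psi> pt = (\<lambda>n. pt (n + s))" using \<psi>\<phi>[OF pt_s] by simp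
  then have "\<psi> (\<lambda>n. n = 0) (- s)" by (simp add: pt_def)
  then have ge: "\<phi> x (q + s)" if "x \<in> ?X" "x q" for x q
    using image_in_translate[OF \<psi> _ Aut_image[OF \<phi> that(1)], of "- s" "q + s"] that
    by (simp add: \<psi>\<phi>)
  have "\<phi> x = (\<lambda>n. x (n + (- s)))" if "x \<in> ?X" for x
  proof
    fix n show "\<phi> x n = x (n + (- s))"
      using le[OF that, of "n - s"] ge[OF that, of "n - s"] by auto
  qed
  then show ?thesis by blast
qed

theorem trivial_Aut_admissible_shift: "trivial_Aut (admissible_shift B)"
proof -
  let ?X = "admissible_shift B"
  note X = subshift_admissible_shift[of B]
  interpret group "Aut ?X" by (rule group_Aut[OF X])
  have s: "restrict shift ?X [^]\<^bsub>Aut ?X\<^esub> n \<in> carrier (Aut ?X)" for n :: int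
    by (rule int_pow_closed[OF restrict_shift_in_Aut[OF X]])
  have "\<exists>n::int. \<phi> = restrict shift ?X [^]\<^bsub>Aut ?X\<^esub> n" if \<phi>: "\<phi> \<in> carrier (Aut ?X)" for \<phi>
  proof -
    obtain k where k: "\<forall>x\<in>?X. \<phi> x = (\<lambda>n. x (n + k))" using Aut_is_shift_power[OF \<phi>] by blast
    have "\<phi> \<in> extensional ?X" "restrict shift ?X [^]\<^bsub>Aut ?X\<^esub> k \<in> extensional ?X"
      using \<phi> s[of k] by (auto simp: Aut_carrier Bij_def)
    then have "\<phi> = restrict shift ?X [^]\<^bsub>Aut ?X\<^esub> k"
      by (rule extensionalityI) (simp add: k shift_power[OF X])
    then show ?thesis by blast
  qed
  then show ?thesis using s by (auto simp: trivial_Aut_def)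
qed

end

section \<open>The dichotomy\<close>

theorem corollary1p2:
  fixes B :: "nat set"
  assumes "B \<subseteq> {0<..} - {1}"
    and "primitive B"
  shows "(\<exists>\<phi>. \<phi> \<in> mon (Aut UNIV) (Aut (admissible_shift B))) \<or> trivial_Aut (admissible_shift B)"
proof -
  interpret moduli B
    by unfold_locales (use assms(1) in force)
  show ?thesis
  proof (cases "not_finitely_forced B")
    case True
    then show ?thesis using not_finitely_forced.trivial_Aut_admissible_shift by blast
  next
    case False
    then have "\<exists>W B0. finite W \<and> admissible_set B W \<and> finite B0 \<and> B0 \<subseteq> B \<and>
        (\<forall>D. W \<subseteq> D \<longrightarrow> admissible_set B0 D \<longrightarrow> admissible_set B D)"
      using moduli_axioms unfolding not_finitely_forced_def not_finitely_forced_axioms_def by blast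
    then obtain W B0 where forced: "finite W" "admissible_set B W" "finite B0" "B0 \<subseteq> B"
      "\<forall>D. W \<subseteq> D \<longrightarrow> admissible_set B0 D \<longrightarrow> admissible_set B D"
      by (elim exE conjE)
    obtain N t A where "N > 0" "t \<ge> 3" "\<forall>n. n + N \<in> A \<longleftrightarrow> n \<in> A" "0 \<in> A" "admissible_set B A"
      "\<forall>D k. admissible_set B D \<longrightarrow> (\<forall>a\<in>A. 0 \<le> a \<longrightarrow> a \<le> t * N \<longrightarrow> a + k \<in> D) \<longrightarrow>
        (\<forall>n\<in>D. n - k \<in> A)"
      by (rule periodic_if_finitely_forced[OF forced])
    then show ?thesis by (intro disjI1 embeds_if_periodic)
  qed
qed

end
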